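(* Let $f:\{-1,1\}^n\to\mathbb{R}$ be a pseudo-boolean function of degree $r\ge 1$ with Fourier expansion $f(x)=\hat f(\emptyset)+\sum_{I\in\mathcal{F}}\hat f(I)\prod_{i\in I}x_i$, where $\mathcal{F}\subseteq\{I:\emptyset\ne I\subseteq[n]\}$ and each $\hat f(I)$, $I\in\mathcal F$, is a non-zero real. Let $A$ be the $(0,1)$-matrix with rows indexed by $i\in[n]$ and columns indexed by the terms $I\in\mathcal F$ (in any order), with entry $1$ iff the term contains $x_i$. Then $$\max_x f(x)\ge \hat f(\emptyset)+\left\lfloor \frac{\mathrm{rank}A+r-1}{r}\right\rfloor\cdot\min\{|\hat f(I)|: I\in\mathcal F\},$$ where the rank is over $\mathbb{F}_2$, and an assignment $x$ attaining this bound can be found in time $(n|\mathcal F|)^{O(1)}$.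
   Context: Every function $f:\{-1,1\}^n\to\mathbb{R}$ can be uniquely written in the stated form (its Fourier expansion); the degree of $f$ is $\max\{|I|: I\in\mathcal F\}$. *)

theory Defs
  imports "Jordan_Normal_Form.DL_Rank" "HOL-Library.Z2" "HOL-Library.FuncSet" Complex_Main
begin

section \<open>Pseudo-boolean functions and their Fourier expansion\<close>

text \<open>Variables are indexed by \<open>{..<n}\<close> instead of \<open>{1..n}\<close>. Points of \<open>{-1,1}^n\<close> are
  extensional functions, so the cube is a finite set. A pseudo-boolean function is a function
  of which only the values on the cube matter.\<close>

definition cube :: "nat \<Rightarrow> (nat \<Rightarrow> real) set" where
  "cube n = {..<n} \<rightarrow>\<^sub>E {-1, 1}"

text \<open>\<open>a {}\<close> is the constant term; the values of \<open>a\<close> outside \<open>insert {} F\<close> are irrelevant.\<close>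

definition fourier_expansion ::
  "nat \<Rightarrow> ((nat \<Rightarrow> real) \<Rightarrow> real) \<Rightarrow> (nat set \<Rightarrow> real) \<Rightarrow> nat set set \<Rightarrow> bool" where
  "fourier_expansion n f a F \<longleftrightarrow>
     F \<subseteq> {I. I \<noteq> {} \<and> I \<subseteq> {..<n}} \<and>
     (\<forall>I\<in>F. a I \<noteq> 0) \<and>
     (\<forall>x\<in>cube n. f x = a {} + (\<Sum>I\<in>F. a I * (\<Prod>i\<in>I. x i)))"

text \<open>The \<open>insert 0\<close> only gives constant functions (empty \<open>F\<close>) the degree \<open>0\<close>.\<close>

definition fourier_degree :: "nat set set \<Rightarrow> nat" where
  "fourier_degree F = Max (insert 0 (card ` F))"

text \<open>The list \<open>Is\<close> fixes the order of the columns. The type \<open>bit\<close> is the field with two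
  elements.\<close>

definition term_matrix :: "nat \<Rightarrow> nat set list \<Rightarrow> bit mat" where
  "term_matrix n Is = mat n (length Is) (\<lambda>(i, j). if i \<in> Is ! j then 1 else 0)"

definition rank_F2 :: "nat \<Rightarrow> nat set list \<Rightarrow> nat" where
  "rank_F2 n Is = vec_space.rank n (term_matrix n Is)"

section \<open>Computation model\<close>

text \<open>
  Programs are while-programs over a random access machine with two separate kinds of arrays:
  arrays of natural numbers and arrays of reals. Scalars are arrays used at index \<open>0\<close> only.
  A fixed program refers to finitely many arrays; array cells are addressed by expressions that
  may themselves read array cells, which gives indirect addressing.

  The only arithmetic is addition and subtraction (truncated on the naturals), and reals can
  influence the control flow and the natural numbers only through comparisons. There is
  deliberately no multiplication at unit cost, no rounding and no real constant except \<open>0\<close>.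
  Hence \<open>t\<close> steps only produce naturals of bit length \<open>O(t)\<close> plus that of the input, and integer
  combinations of the input reals with coefficients of bit length \<open>O(t)\<close>. In particular, on rational
  inputs a polynomial step count means polynomial time on a Turing machine as well.

  Each assignment and each test costs one step. The expressions of a fixed program have bounded
  size, so that counting their operations would change the running time by a constant factor only.
\<close>

type_synonym vname = string

record state =
  nats :: "vname \<Rightarrow> nat \<Rightarrow> nat"
  reals :: "vname \<Rightarrow> nat \<Rightarrow> real"

datatype nexp = NConst nat | NCell vname nexp | NAdd nexp nexp | NSub nexp nexp

datatype rexp = RZero | RCell vname nexp | RAdd rexp rexp | RSub rexp rexp

datatype bexp = NLess nexp nexp | RLess rexp rexp | BNot bexp | BAnd bexp bexp

datatype com =
    Skip
  | NAssign vname nexp nexp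
  | RAssign vname nexp rexp
  | Seq com com
  | Cond bexp com com
  | While bexp com

primrec nval :: "nexp \<Rightarrow> state \<Rightarrow> nat" where
  "nval (NConst k) s = k"
| "nval (NCell v e) s = nats s v (nval e s)"
| "nval (NAdd e1 e2) s = nval e1 s + nval e2 s"
| "nval (NSub e1 e2) s = nval e1 s - nval e2 s"

primrec rval :: "rexp \<Rightarrow> state \<Rightarrow> real" where
  "rval RZero s = 0"
| "rval (RCell v e) s = reals s v (nval e s)"
| "rval (RAdd e1 e2) s = rval e1 s + rval e2 s"
| "rval (RSub e1 e2) s = rval e1 s - rval e2 s"

primrec bval :: "bexp \<Rightarrow> state \<Rightarrow> bool" where
  "bval (NLess e1 e2) s \<longleftrightarrow> nval e1 s < nval e2 s"
| "bval (RLess e1 e2) s \<longleftrightarrow> rval e1 s < rval e2 s"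
| "bval (BNot b) s \<longleftrightarrow> \<not> bval b s"
| "bval (BAnd b1 b2) s \<longleftrightarrow> bval b1 s \<and> bval b2 s"

definition write_nat :: "vname \<Rightarrow> nat \<Rightarrow> nat \<Rightarrow> state \<Rightarrow> state" where
  "write_nat v i k s = s\<lparr>nats := (nats s)(v := (nats s v)(i := k))\<rparr>"

definition write_real :: "vname \<Rightarrow> nat \<Rightarrow> real \<Rightarrow> state \<Rightarrow> state" where
  "write_real v i y s = s\<lparr>reals := (reals s)(v := (reals s v)(i := y))\<rparr>"

text \<open>\<open>exec c s t s'\<close>: started in \<open>s\<close>, the program \<open>c\<close> halts after \<open>t\<close> steps in \<open>s'\<close>.\<close>

inductive exec :: "com \<Rightarrow> state \<Rightarrow> nat \<Rightarrow> state \<Rightarrow> bool" where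
  Skip: "exec Skip s 1 s"
| NAssign: "exec (NAssign v e1 e2) s 1 (write_nat v (nval e1 s) (nval e2 s) s)"
| RAssign: "exec (RAssign v e1 e2) s 1 (write_real v (nval e1 s) (rval e2 s) s)"
| Seq: "exec c1 s1 t1 s2 \<Longrightarrow> exec c2 s2 t2 s3 \<Longrightarrow> exec (Seq c1 c2) s1 (t1 + t2) s3"
| CondTrue: "bval b s \<Longrightarrow> exec c1 s t s' \<Longrightarrow> exec (Cond b c1 c2) s (Suc t) s'"
| CondFalse: "\<not> bval b s \<Longrightarrow> exec c2 s t s' \<Longrightarrow> exec (Cond b c1 c2) s (Suc t) s'"
| WhileFalse: "\<not> bval b s \<Longrightarrow> exec (While b c) s 1 s"
| WhileTrue: "bval b s1 \<Longrightarrow> exec c s1 t1 s2 \<Longrightarrow> exec (While b c) s2 t2 s3 \<Longrightarrow>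
    exec (While b c) s1 (Suc (t1 + t2)) s3"

inductive_cases exec_SkipE: "exec Skip s t s'"
inductive_cases exec_NAssignE: "exec (NAssign v e1 e2) s t s'"
inductive_cases exec_RAssignE: "exec (RAssign v e1 e2) s t s'"
inductive_cases exec_SeqE: "exec (Seq c1 c2) s t s'"
inductive_cases exec_CondE: "exec (Cond b c1 c2) s t s'"
inductive_cases exec_WhileE: "exec (While b c) s t s'"

lemma exec_deterministic:
  "exec c s t s' \<Longrightarrow> exec c s u s'' \<Longrightarrow> t = u \<and> s' = s''"
proof (induction arbitrary: u s'' rule: exec.induct)
  case (Skip s) then show ?case by (auto elim: exec_SkipE)
next
  case (NAssign v e1 e2 s) then show ?case by (auto elim: exec_NAssignE)
next
  case (RAssign v e1 e2 s) then show ?case by (auto elim: exec_RAssignE)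
next
  case (Seq c1 s1 t1 s2 c2 t2 s3)
  from Seq.prems show ?case by (rule exec_SeqE) (use Seq.IH in blast)
next
  case (CondTrue b s c1 t s' c2)
  from CondTrue.prems show ?case by (rule exec_CondE) (use CondTrue in blast)+
next
  case (CondFalse b s c2 t s' c1)
  from CondFalse.prems show ?case by (rule exec_CondE) (use CondFalse in blast)+
next
  case (WhileFalse b s c)
  from WhileFalse.prems show ?case by (rule exec_WhileE) (use WhileFalse in auto)
next
  case (WhileTrue b s1 c t1 s2 t2 s3)
  from WhileTrue.prems show ?case by (rule exec_WhileE) (use WhileTrue in blast)+
qed

text \<open>The input consists of \<open>n\<close>, the number of terms, the 0/1-matrix stored column by column
  (entry \<open>(i, j)\<close> in cell \<open>j * n + i\<close> of array \<open>A\<close>), the constant term, and the coefficients in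
  the order of the columns. All other cells are \<open>0\<close>.\<close>

definition input_state :: "nat \<Rightarrow> (nat set \<Rightarrow> real) \<Rightarrow> nat set list \<Rightarrow> state" where
  "input_state n a Is =
    \<lparr>nats = (\<lambda>v k.
       if v = ''n'' \<and> k = 0 then n
       else if v = ''m'' \<and> k = 0 then length Is
       else if v = ''A'' \<and> k < length Is * n \<and> k mod n \<in> Is ! (k div n) then 1
       else 0),
     reals = (\<lambda>v k.
       if v = ''const'' \<and> k = 0 then a {}
       else if v = ''coeff'' \<and> k < length Is then a (Is ! k)
       else 0)\<rparr>"

text \<open>The output point is read off array \<open>x\<close>: cell \<open>i\<close> is \<open>0\<close> iff \<open>x\<^sub>i = 1\<close>.\<close>

definition output_point :: "nat \<Rightarrow> state \<Rightarrow> (nat \<Rightarrow> real)" where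
  "output_point n s = (\<lambda>i\<in>{..<n}. if nats s ''x'' i = 0 then 1 else -1)"

end

theory Submission
  imports Defs
begin

text \<open>
  A term of the expansion is the character of a vector over the two-element field, namely its
  column of the matrix. If the columns of a set \<open>K\<close> of terms are independent and
  their span contains no further column, then the terms of \<open>K\<close> can be made positive
  simultaneously, and the expectation of \<open>f\<close> under these
  equations is the constant term plus the sum of the \<open>\<bar>a I\<bar>\<close> with \<open>I\<close> in \<open>K\<close>. The method of
  conditional expectations then finds a point that is at least as good.

  To get such a \<open>K\<close> with \<open>r * card K \<ge> rank\<close>, take a set \<open>R\<close> of \<open>rank\<close> pivot rows and write
  some vector that is \<open>1\<close> on all of \<open>R\<close> as a sum of columns. As each column has at most \<open>r\<close>
  ones, every such sum has at least \<open>rank / r\<close> summands. As long as \<open>K\<close> is dependent or a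
  column outside \<open>K\<close> is a sum of columns in \<open>K\<close>, adding the corresponding linear relation
  (which does not change the sum) makes \<open>K\<close> smaller.
\<close>

section \<open>Program logic\<close>

text \<open>The condition that the span contain no further column is the crux. A term whose column
  lies in the span becomes constant under the equations as well, with a sign that nobody chose, and
  may cancel the gain. A maximal independent set is therefore the wrong choice; a possibly much
  smaller set is sought, and the sum of its columns, not its rank, guards against losing too many
  terms. One elimination routine serves every purpose. Its sign row makes it a run of conditional
  expectations: a character is fixed by the sign of the total coefficient of all terms that
  currently reduce to it. Its tag rows exhibit the linear relations. The all-ones column is reduced
  along with the others; its residue vanishes on the pivot rows, so the terms that were added to it
  form the starting sum. Applied to the columns of the variables as well, the routine ends in a
  single point.\<close>

primrec nat_writes :: "com \<Rightarrow> vname set" where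
  "nat_writes Skip = {}"
| "nat_writes (NAssign v e1 e2) = {v}"
| "nat_writes (RAssign v e1 e2) = {}"
| "nat_writes (Seq c1 c2) = nat_writes c1 \<union> nat_writes c2"
| "nat_writes (Cond b c1 c2) = nat_writes c1 \<union> nat_writes c2"
| "nat_writes (While b c) = nat_writes c"

primrec real_writes :: "com \<Rightarrow> vname set" where
  "real_writes Skip = {}"
| "real_writes (NAssign v e1 e2) = {}"
| "real_writes (RAssign v e1 e2) = {v}"
| "real_writes (Seq c1 c2) = real_writes c1 \<union> real_writes c2"
| "real_writes (Cond b c1 c2) = real_writes c1 \<union> real_writes c2"
| "real_writes (While b c) = real_writes c"

definition frame :: "com \<Rightarrow> state \<Rightarrow> state \<Rightarrow> bool" where
  "frame c s s' \<longleftrightarrow> (\<forall>u. u \<notin> nat_writes c \<longrightarrow> nats s' u = nats s u) \<and>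
    (\<forall>u. u \<notin> real_writes c \<longrightarrow> reals s' u = reals s u)"

lemma write_simps [simp]:
  "nats (write_nat v i k s) = (nats s)(v := (nats s v)(i := k))"
  "reals (write_nat v i k s) = reals s"
  "nats (write_real v i y s) = nats s"
  "reals (write_real v i y s) = (reals s)(v := (reals s v)(i := y))"
  by (simp_all add: write_nat_def write_real_def)

lemma frame_trans:
  "frame c1 s1 s2 \<Longrightarrow> frame c2 s2 s3 \<Longrightarrow> nat_writes c1 \<subseteq> nat_writes c \<Longrightarrow> nat_writes c2 \<subseteq> nat_writes c \<Longrightarrow>
    real_writes c1 \<subseteq> real_writes c \<Longrightarrow> real_writes c2 \<subseteq> real_writes c \<Longrightarrow> frame c s1 s3"
  unfolding frame_def by (metis subsetD)

lemma exec_frame: "exec c s t s' \<Longrightarrow> frame c s s'"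
proof (induction rule: exec.induct)
  case (Seq c1 s1 t1 s2 c2 t2 s3)
  then show ?case by (intro frame_trans[of c1 s1 s2 c2 s3]) auto
next
  case (WhileTrue b s1 c t1 s2 t2 s3)
  then show ?case by (intro frame_trans[of c s1 s2 "While b c" s3]) auto
qed (auto simp: frame_def)

section \<open>Polynomial bounds on the running time\<close>

text \<open>A bound on the running time if every execution of a loop has at most \<open>N\<close> iterations.\<close>

primrec cost :: "nat \<Rightarrow> com \<Rightarrow> nat" where
  "cost N Skip = 1"
| "cost N (NAssign v e1 e2) = 1"
| "cost N (RAssign v e1 e2) = 1"
| "cost N (Seq c1 c2) = cost N c1 + cost N c2"
| "cost N (Cond b c1 c2) = Suc (cost N c1 + cost N c2)"
| "cost N (While b c) = Suc (N * Suc (cost N c))"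

lemma poly_add:
  fixes f g :: "nat \<Rightarrow> nat"
  assumes "\<forall>N\<ge>1. f N \<le> C * N ^ d" "\<forall>N\<ge>1. g N \<le> C' * N ^ d'"
  shows "\<forall>N\<ge>1. f N + g N \<le> (C + C') * N ^ (d + d')"
proof (intro allI impI)
  fix N :: nat assume N: "1 \<le> N"
  have "f N \<le> C * N ^ (d + d')" "g N \<le> C' * N ^ (d + d')"
    using assms N by (meson order_trans mult_le_mono2 power_increasing le_add1 le_add2)+
  then show "f N + g N \<le> (C + C') * N ^ (d + d')" by (simp add: add_mult_distrib)
qed

text \<open>Only a loop multiplies the cost, by one factor of order \<open>N\<close>, so the
  exponent depends on the program text alone.\<close>

lemma cost_poly: "\<exists>C d. \<forall>N\<ge>1. cost N c \<le> C * N ^ d"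
proof (induction c)
  case (Seq c1 c2)
  then obtain C d C' d' where "\<forall>N\<ge>1. cost N c1 \<le> C * N ^ d" "\<forall>N\<ge>1. cost N c2 \<le> C' * N ^ d'" by blast
  from poly_add[OF this] show ?case unfolding cost.simps by blast
next
  case (Cond b c1 c2)
  then obtain C d C' d' where "\<forall>N\<ge>1. cost N c1 \<le> C * N ^ d" "\<forall>N\<ge>1. cost N c2 \<le> C' * N ^ d'" by blast
  from poly_add[OF poly_add[OF this], of "\<lambda>_. 1" 1 0]
  have "\<forall>N\<ge>1. cost N (Cond b c1 c2) \<le> (C + C' + 1) * N ^ (d + d' + 0)" by simp
  then show ?case by blast
next
  case (While b c)
  then obtain C d where *: "\<forall>N\<ge>1. cost N c \<le> C * N ^ d" by blast
  \<comment> \<open>\<open>C\<close> pays for the loop bodies; the additional 2 pays for the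
    \<open>N\<close> successful tests and the final failing one.\<close>
  have "Suc (N * Suc (cost N c)) \<le> (C + 2) * N ^ Suc d" if N: "N \<ge> 1" for N
  proof -
    define P where "P = N ^ Suc d"
    have "N * cost N c \<le> C * P" using * N by (simp add: P_def mult.left_commute)
    moreover have "N \<le> P" "1 \<le> P" using N by (simp_all add: P_def)
    ultimately have "1 + N + N * cost N c \<le> P + P + C * P" by linarith
    then have "Suc (N * Suc (cost N c)) \<le> (C + 2) * P" by (simp add: add_mult_distrib)
    then show ?thesis unfolding P_def .
  qed
  then show ?case unfolding cost.simps by blast
qed (auto intro: exI[of _ 1] exI[of _ 0])

text \<open>Total correctness together with the time bound.\<close>

definition wp :: "nat \<Rightarrow> com \<Rightarrow> (state \<Rightarrow> bool) \<Rightarrow> state \<Rightarrow> bool" where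
  "wp N c Q s \<longleftrightarrow> (\<exists>t s'. exec c s t s' \<and> t \<le> cost N c \<and> Q s')"

lemma wp_Skip: "Q s \<Longrightarrow> wp N Skip Q s"
  unfolding wp_def cost.simps by (blast intro: exec.Skip)

lemma wp_NAssign: "Q (write_nat v (nval e1 s) (nval e2 s) s) \<Longrightarrow> wp N (NAssign v e1 e2) Q s"
  unfolding wp_def cost.simps by (blast intro: exec.NAssign)

lemma wp_RAssign: "Q (write_real v (nval e1 s) (rval e2 s) s) \<Longrightarrow> wp N (RAssign v e1 e2) Q s"
  unfolding wp_def cost.simps by (blast intro: exec.RAssign)

lemma wp_Seq: "wp N c1 (wp N c2 Q) s \<Longrightarrow> wp N (Seq c1 c2) Q s"
  unfolding wp_def cost.simps by (blast intro: exec.Seq add_le_mono)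

lemma wp_Cond:
  assumes "bval b s \<Longrightarrow> wp N c1 Q s" "\<not> bval b s \<Longrightarrow> wp N c2 Q s"
  shows "wp N (Cond b c1 c2) Q s"
proof (cases "bval b s")
  case True
  with assms(1) obtain t s' where "exec c1 s t s'" "t \<le> cost N c1" "Q s'" by (auto simp: wp_def)
  then show ?thesis unfolding wp_def
    using exec.CondTrue[OF True] by (intro exI[of _ "Suc t"] exI[of _ s']) auto
next
  case False
  with assms(2) obtain t s' where "exec c2 s t s'" "t \<le> cost N c2" "Q s'" by (auto simp: wp_def)
  then show ?thesis unfolding wp_def
    using exec.CondFalse[OF False] by (intro exI[of _ "Suc t"] exI[of _ s']) auto
qed

lemma wp_conseq:
  assumes "wp N c Q s" "\<And>s'. frame c s s' \<Longrightarrow> Q s' \<Longrightarrow> Q' s'"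
  shows "wp N c Q' s"
  using assms exec_frame unfolding wp_def by blast

abbreviation cell :: "vname \<Rightarrow> nexp" where
  "cell v \<equiv> NCell v (NConst 0)"

definition For :: "vname \<Rightarrow> vname \<Rightarrow> com \<Rightarrow> com" where
  "For v b c = Seq (NAssign v (NConst 0) (NConst 0))
    (While (NLess (cell v) (cell b)) (Seq c (NAssign v (NConst 0) (NAdd (cell v) (NConst 1)))))"

lemma writes_For [simp]:
  "nat_writes (For v b c) = insert v (nat_writes c)"
  "real_writes (For v b c) = real_writes c"
  by (auto simp: For_def)

text \<open>The body receives the frame fact of the loop so far, so invariants need to mention only
  what the loop changes; \<open>stable\<close> carries an invariant over the writes to the counter.
  When the rule is applied with \<open>goal_cases\<close>, case 8 is the body and case 9 the
  exit.\<close>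

lemma wp_For:
  assumes K: "nats s b 0 = K" "K \<le> N"
    and v: "v \<notin> nat_writes c" "b \<notin> nat_writes c" "v \<noteq> b"
    and Inv0: "Inv 0 s"
    and stable: "\<And>k x s'. Inv k s' \<Longrightarrow> Inv k (write_nat v 0 x s')"
    and body: "\<And>k s'. k < K \<Longrightarrow> Inv k s' \<Longrightarrow> nats s' v 0 = k \<Longrightarrow> frame (For v b c) s s' \<Longrightarrow> wp N c (Inv (Suc k)) s'"
    and post: "\<And>s'. Inv K s' \<Longrightarrow> frame (For v b c) s s' \<Longrightarrow> Q s'"
  shows "wp N (For v b c) Q s"
proof -
  let ?inc = "NAssign v (NConst 0) (NAdd (cell v) (NConst 1))"
  let ?W = "While (NLess (cell v) (cell b)) (Seq c ?inc)"
  \<comment> \<open>The induction runs over the iterations still to come, hence the counter value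
    \<open>K - k\<close>.\<close>
  have loop: "\<exists>t s''. exec ?W s' t s'' \<and> t \<le> Suc (k * Suc (Suc (cost N c))) \<and> Inv K s''"
    if "k \<le> K" "Inv (K - k) s'" "nats s' v 0 = K - k" "frame (For v b c) s s'" for k s'
    using that
  proof (induction k arbitrary: s')
    case 0
    have "\<not> bval (NLess (cell v) (cell b)) s'"
      using 0 K v by (auto simp: frame_def)
    from exec.WhileFalse[OF this] show ?case using 0 by auto
  next
    case (Suc k)
    let ?k = "K - Suc k"
    have k: "?k < K" "K - k = Suc ?k" using Suc.prems by auto
    have b: "nats s' b 0 = K" using Suc.prems(4) K v by (auto simp: frame_def)
    then have tr: "bval (NLess (cell v) (cell b)) s'" using Suc.prems k by simp
    obtain t1 s1 where e1: "exec c s' t1 s1" "t1 \<le> cost N c" "Inv (Suc ?k) s1"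
      using body[OF k(1) Suc.prems(2-4)] by (auto simp: wp_def)
    let ?s2 = "write_nat v (nval (NConst 0) s1) (nval (NAdd (cell v) (NConst 1)) s1) s1"
    note f1 = exec_frame[OF e1(1)]
    have e2: "exec (Seq c ?inc) s' (t1 + 1) ?s2"
      by (rule exec.Seq[OF e1(1) exec.NAssign])
    have "nats s1 v = nats s' v" using f1 v by (auto simp: frame_def)
    then have v2: "nats ?s2 v 0 = K - k" using Suc.prems(3) k by simp
    have I2: "Inv (K - k) ?s2" using stable[OF e1(3)] k by simp
    have f2: "frame (For v b c) s ?s2"
      using Suc.prems(4) exec_frame[OF e2] by (rule frame_trans) auto
    obtain t3 s3 where e3: "exec ?W ?s2 t3 s3" "t3 \<le> Suc (k * Suc (Suc (cost N c)))" "Inv K s3"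
      using Suc.IH[OF _ I2 v2 f2] Suc.prems(1) by auto
    show ?case
      using exec.WhileTrue[OF tr e2 e3(1)] e3 e1(2)
      by (intro exI[of _ "Suc (t1 + 1 + t3)"] exI[of _ s3]) auto
  qed
  let ?s0 = "write_nat v (nval (NConst 0) s) (nval (NConst 0) s) s"
  have "frame (For v b c) s ?s0" by (auto simp: frame_def)
  moreover have "Inv (K - K) ?s0" using stable[OF Inv0, of 0] by simp
  ultimately obtain t s' where e: "exec ?W ?s0 t s'" "t \<le> Suc (K * Suc (Suc (cost N c)))" "Inv K s'"
    using loop[of K ?s0] by auto
  have ex: "exec (For v b c) s (1 + t) s'"
    unfolding For_def by (rule exec.Seq[OF exec.NAssign e(1)])
  have "K * Suc (Suc (cost N c)) \<le> N * Suc (Suc (cost N c))" using K(2) by (rule mult_le_mono1)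
  then have "1 + t \<le> cost N (For v b c)" using e(2) by (simp add: For_def)
  then show ?thesis unfolding wp_def using ex post[OF e(3) exec_frame[OF ex]] by blast
qed

section \<open>Elimination over the two-element field\<close>

text \<open>Bits stay in ring notation, so that distributivity and the rules for finite sums
  apply.\<close>

declare add_bit_eq_xor [simp del] mult_bit_eq_and [simp del]

lemma bit_add_self [simp]: "(b::bit) + b = 0"
  by (cases b) simp_all

text \<open>The non-trivial character of the two-element field: a product of variables becomes the
  sign of a sum of bits.\<close>

definition sg :: "bit \<Rightarrow> real" where
  "sg b = (if b = 1 then -1 else 1)"

lemma sg_add: "sg (a + b) = sg a * sg b"
  by (cases a; cases b) (simp_all add: sg_def)

lemma sum_bit_mult:
  fixes \<alpha> g :: "'a \<Rightarrow> bit"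
  assumes "finite A"
  shows "(\<Sum>s\<in>A. \<alpha> s * g s) = (\<Sum>s\<in>{s\<in>A. \<alpha> s = 1}. g s)"
proof (rule sum.mono_neutral_cong_right)
  show "\<forall>s\<in>A - {s \<in> A. \<alpha> s = 1}. \<alpha> s * g s = 0" by auto
qed (use assms in auto)

lemma sum_bit_sym_diff:
  fixes g :: "'a \<Rightarrow> bit"
  assumes "finite A" "finite B"
  shows "sum g (sym_diff A B) = sum g A + sum g B"
proof -
  have "sum g A = sum g (A - B) + sum g (A \<inter> B)"
    using sum.Int_Diff[OF assms(1), of g B] by (simp add: add.commute)
  moreover have "sum g B = sum g (B - A) + sum g (A \<inter> B)"
    using sum.Int_Diff[OF assms(2), of g A] by (simp add: add.commute Int_commute)
  moreover have "sum g (sym_diff A B) = sum g (A - B) + sum g (B - A)"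
    using assms by (intro sum.union_disjoint) auto
  ultimately show ?thesis
    by (cases "sum g (A \<inter> B)") (simp_all add: ac_simps)
qed

lemma prod_sg: "finite A \<Longrightarrow> (\<Prod>i\<in>A. sg (z i)) = sg (\<Sum>i\<in>A. z i)"
proof (induction A rule: finite_induct)
  case empty
  show ?case by (simp add: sg_def)
qed (simp add: sg_add)

text \<open>\<open>I t\<close> is the incidence vector of term \<open>t\<close>, and
  \<open>c t\<close> is its coefficient.\<close>

locale term_system =
  fixes n m :: nat and I :: "nat \<Rightarrow> nat \<Rightarrow> bit" and c :: "nat \<Rightarrow> real"
begin

definition q :: nat where "q = n + m"

text \<open>The working matrix has \<open>q + 1\<close> columns (first index) and \<open>q + 1\<close> rows. Columns below \<open>n\<close> are
  unit vectors, which stand for the variables, column \<open>n + t\<close> is term \<open>t\<close>, and column \<open>q\<close> is the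
  all-ones vector. Rows below \<open>n\<close> hold the vectors themselves, row \<open>n + s\<close> records whether
  column \<open>n + s\<close> has been added, and row \<open>q\<close> holds the sign bit.\<close>

definition V0 :: "nat \<Rightarrow> nat \<Rightarrow> bit" where
  "V0 j i = of_bool (i = j \<or> i < n \<and> (n \<le> j \<and> j < q \<and> I (j - n) i = 1 \<or> j = q))"

text \<open>A null column is a character whose value is determined by the equations imposed so far;
  row \<open>q\<close> holds that value.\<close>

definition null :: "(nat \<Rightarrow> nat \<Rightarrow> bit) \<Rightarrow> nat \<Rightarrow> bool" where
  "null V j \<longleftrightarrow> (\<forall>i<n. V j i = 0)"

text \<open>These characters agree up to sign with that of column \<open>p\<close> wherever the
  equations hold, so one equation decides all of them.\<close>

definition same :: "(nat \<Rightarrow> nat \<Rightarrow> bit) \<Rightarrow> nat \<Rightarrow> nat set" where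
  "same V p = {t. t < m \<and> (\<forall>i<n. V (n + t) i = V p i)}"

definition weight :: "(nat \<Rightarrow> nat \<Rightarrow> bit) \<Rightarrow> nat \<Rightarrow> real" where
  "weight V p = (\<Sum>t\<in>same V p. c t * sg (V (n + t) q))"

text \<open>The last index with entry 1 is the one that an overwriting scan leaves behind.\<close>

definition pivot :: "(nat \<Rightarrow> nat \<Rightarrow> bit) \<Rightarrow> nat \<Rightarrow> nat" where
  "pivot V p = Max {i. i < n \<and> V p i = 1}"

text \<open>The row \<open>q\<close> makes the sign of the character \<open>p\<close> agree with the sign of its total weight.\<close>

definition pvec :: "(nat \<Rightarrow> nat \<Rightarrow> bit) \<Rightarrow> nat \<Rightarrow> nat \<Rightarrow> bit" where
  "pvec V p i = (if i = q then of_bool (weight V p < 0) else V p i)"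

text \<open>Imposes the equation that the reduced character of \<open>p\<close> takes the sign of
  its weight, solves it for the variable \<open>pivot V p\<close>, and substitutes in all
  columns.\<close>

definition step :: "nat \<Rightarrow> (nat \<Rightarrow> nat \<Rightarrow> bit) \<Rightarrow> nat \<Rightarrow> nat \<Rightarrow> bit" where
  "step p V = (if null V p then V else (\<lambda>j i. V j i + V j (pivot V p) * pvec V p i))"

primrec run :: "(nat \<Rightarrow> bool) \<Rightarrow> nat \<Rightarrow> (nat \<Rightarrow> nat \<Rightarrow> bit) \<Rightarrow> nat \<Rightarrow> nat \<Rightarrow> bit" where
  "run K 0 V = V"
| "run K (Suc k) V = (if K k then step k (run K k V) else run K k V)"

lemma pivot:
  assumes "\<not> null V p"
  shows "pivot V p < n" "V p (pivot V p) = 1"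
proof -
  have "pivot V p \<in> {i. i < n \<and> V p i = 1}"
    unfolding pivot_def using assms by (intro Max_in) (auto simp: null_def)
  then show "pivot V p < n" "V p (pivot V p) = 1" by auto
qed

text \<open>A null column has entry 0 in the pivot row and is never touched again: its sign bit and
  its tags are final.\<close>

lemma step_null: "null V j \<Longrightarrow> step p V j = V j"
  using pivot(1)[of V p] by (auto simp: step_def null_def)

lemma run_induct:
  assumes "P 0 V" "\<And>k V. k < l \<Longrightarrow> P k V \<Longrightarrow> \<not> K k \<Longrightarrow> P (Suc k) V"
    "\<And>k V. k < l \<Longrightarrow> P k V \<Longrightarrow> K k \<Longrightarrow> P (Suc k) (step k V)"
  shows "P l (run K l V)"
proof -
  have "j \<le> l \<Longrightarrow> P j (run K j V)" for j
    by (induction j) (use assms in auto)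
  then show ?thesis by blast
qed

lemma step_self_null: "null (step p V) p"
  using pivot(2)[of V p] by (auto simp: step_def null_def pvec_def q_def)

lemma run_null:
  assumes "K p" "p < l"
  shows "null (run K l V) p"
  using assms(2)
proof (induction l)
  case (Suc l)
  show ?case
  proof (cases "p = l")
    case True
    then show ?thesis using assms(1) by (simp add: step_self_null)
  next
    case False
    with Suc have "null (run K l V) p" by simp
    then show ?thesis by (simp add: null_def step_null)
  qed
qed simp

subsection \<open>Invariants\<close>

text \<open>Read in row \<open>q\<close>, this says that the sign of a term is the product of the
  signs of its variables. The tag rows are left out, since a term starts with its own tag and the
  variables start with none.\<close>

definition linear :: "(nat \<Rightarrow> nat \<Rightarrow> bit) \<Rightarrow> bool" where
  "linear V \<longleftrightarrow> (\<forall>t<m. \<forall>i. i < n \<or> i = q \<longrightarrow> V (n + t) i = (\<Sum>k<n. I t k * V k i))"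

lemma linearD:
  "linear V \<Longrightarrow> t < m \<Longrightarrow> i < n \<or> i = q \<Longrightarrow> V (n + t) i = (\<Sum>k<n. I t k * V k i)"
  unfolding linear_def by blast

lemma linear_V0: "linear V0"
proof -
  have "V0 (n + t) i = (\<Sum>k<n. I t k * V0 k i)" if "t < m" "i < n \<or> i = q" for t i
  proof -
    have "(\<Sum>k<n. I t k * V0 k i) = (\<Sum>k<n. if k = i then I t k else 0)"
      by (rule sum.cong) (auto simp: V0_def q_def)
    also have "\<dots> = (if i < n then I t i else 0)" by simp
    also have "\<dots> = V0 (n + t) i"
      using that by (cases "I t i") (auto simp: V0_def q_def)
    finally show ?thesis by simp
  qed
  then show ?thesis by (auto simp: linear_def)
qed

text \<open>Every column undergoes the same linear map, the addition of a fixed vector scaled by the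
  entry in the pivot row.\<close>

lemma linear_step:
  assumes "linear V"
  shows "linear (step p V)"
proof (cases "null V p")
  case False
  let ?l = "pivot V p"
  have "step p V (n + t) i = (\<Sum>k<n. I t k * step p V k i)"
    if "t < m" "i < n \<or> i = q" for t i
  proof -
    have *: "V (n + t) ?l = (\<Sum>k<n. I t k * V k ?l)"
      using linearD[OF assms that(1)] pivot(1)[OF False] by blast
    have "step p V (n + t) i
        = (\<Sum>k<n. I t k * V k i) + (\<Sum>k<n. I t k * V k ?l) * pvec V p i"
      by (simp only: step_def False if_False linearD[OF assms that] *)
    also have "\<dots> = (\<Sum>k<n. I t k * step p V k i)"
      by (simp only: step_def False if_False distrib_left sum.distrib sum_distrib_right mult.assoc)
    finally show ?thesis .
  qed
  then show ?thesis by (auto simp: linear_def)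
qed (use assms in \<open>simp add: step_def\<close>)

lemma linear_run: "linear V \<Longrightarrow> linear (run K l V)"
  by (rule run_induct[of "\<lambda>_. linear"]) (auto intro: linear_step)

text \<open>The tag rows act like the identity block in Gauss-Jordan elimination: they record which
  original terms make up a column.\<close>

definition tagged :: "(nat \<Rightarrow> nat \<Rightarrow> bit) \<Rightarrow> bool" where
  "tagged V \<longleftrightarrow> (\<forall>j\<in>{n..q}. \<forall>i<n. V j i = of_bool (j = q) + (\<Sum>s<m. V j (n + s) * I s i))"

lemma tagged_V0: "tagged V0"
proof -
  have "V0 j i = of_bool (j = q) + (\<Sum>s<m. V0 j (n + s) * I s i)" if "n \<le> j" "j \<le> q" "i < n" for j i
  proof -
    have "(\<Sum>s<m. V0 j (n + s) * I s i) = (\<Sum>s<m. if s = j - n then I s i else 0)"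
      using that by (intro sum.cong) (auto simp: V0_def q_def)
    also have "\<dots> = (if j - n < m then I (j - n) i else 0)" by simp
    finally show ?thesis
      using that by (cases "I (j - n) i") (auto simp: V0_def q_def)
  qed
  then show ?thesis by (auto simp: tagged_def)
qed

lemma tagged_step:
  assumes "tagged V" "n \<le> p" "p < q"
  shows "tagged (step p V)"
proof (cases "null V p")
  case False
  let ?l = "pivot V p"
  have "step p V j i = of_bool (j = q) + (\<Sum>s<m. step p V j (n + s) * I s i)"
    if "n \<le> j" "j \<le> q" "i < n" for i j
  proof -
    have "V p i = (\<Sum>s<m. V p (n + s) * I s i)"
      using assms that by (auto simp: tagged_def)
    moreover have "step p V j i = V j i + V j ?l * V p i"
      using False that by (simp add: step_def pvec_def q_def)
    moreover have "V j i = of_bool (j = q) + (\<Sum>s<m. V j (n + s) * I s i)"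
      using assms(1) that by (auto simp: tagged_def)
    ultimately have "step p V j i = of_bool (j = q) + (\<Sum>s<m. V j (n + s) * I s i)
        + V j ?l * (\<Sum>s<m. V p (n + s) * I s i)"
      by simp
    also have "\<dots> = of_bool (j = q) + (\<Sum>s<m. (V j (n + s) + V j ?l * V p (n + s)) * I s i)"
      by (simp add: sum_distrib_left sum.distrib algebra_simps)
    also have "(\<Sum>s<m. (V j (n + s) + V j ?l * V p (n + s)) * I s i) = (\<Sum>s<m. step p V j (n + s) * I s i)"
      using False by (intro sum.cong) (auto simp: step_def pvec_def q_def)
    finally show ?thesis .
  qed
  then show ?thesis by (auto simp: tagged_def)
qed (use assms in \<open>simp add: step_def\<close>)

text \<open>The tag that a term has of itself is lost exactly when it is used as a pivot column.\<close>

definition basis :: "(nat \<Rightarrow> nat \<Rightarrow> bit) \<Rightarrow> nat set" where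
  "basis V = {t. t < m \<and> V (n + t) (n + t) = 0}"

text \<open>\<open>R\<close> collects the pivot rows used so far, one for each basis term. Reduction
  is complete, so all terms and the all-ones column vanish there.\<close>

definition pivotal :: "(nat \<Rightarrow> nat \<Rightarrow> bit) \<Rightarrow> nat set \<Rightarrow> bool" where
  "pivotal V R \<longleftrightarrow> R \<subseteq> {..<n} \<and> card R = card (basis V) \<and> (\<forall>j\<in>{n..q}. \<forall>l\<in>R. V j l = 0)"

definition echelon :: "(nat \<Rightarrow> bool) \<Rightarrow> nat \<Rightarrow> (nat \<Rightarrow> nat \<Rightarrow> bit) \<Rightarrow> bool" where
  "echelon K k V \<longleftrightarrow>
    (\<forall>j\<in>{n..q}. \<forall>s<m. j \<noteq> n + s \<longrightarrow> V j (n + s) = 1 \<longrightarrow> s \<in> basis V) \<and>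
    (\<forall>s\<in>basis V. n + s < k \<and> K (n + s) \<and> null V (n + s)) \<and>
    (\<exists>R. pivotal V R)"

lemma echelon_tag:
  "echelon K k V \<Longrightarrow> n \<le> j \<Longrightarrow> j \<le> q \<Longrightarrow> s < m \<Longrightarrow> j \<noteq> n + s \<Longrightarrow> V j (n + s) = 1 \<Longrightarrow> s \<in> basis V"
  by (auto simp: echelon_def)

lemma echelon_tag_0:
  "echelon K k V \<Longrightarrow> n \<le> j \<Longrightarrow> j \<le> q \<Longrightarrow> s < m \<Longrightarrow> j \<noteq> n + s \<Longrightarrow> s \<notin> basis V \<Longrightarrow> V j (n + s) = 0"
  using echelon_tag bit_not_zero_iff by blast

lemma echelon_V0: "echelon K 0 V0"
proof -
  have b: "basis V0 = {}" by (auto simp: basis_def V0_def)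
  then have "pivotal V0 {}" by (simp add: pivotal_def)
  then show ?thesis by (auto simp: echelon_def b V0_def)
qed

text \<open>The tag of \<open>u\<close> in its own column cancels. Any other own tag survives: a
  basis column is null and hence frozen, and for \<open>t\<close> outside the basis the pivot column
  carries no tag \<open>t\<close>.\<close>

lemma basis_step:
  assumes "echelon K (n + u) V" "u < m" "\<not> null V (n + u)"
  shows "basis (step (n + u) V) = insert u (basis V)" "u \<notin> basis V"
proof -
  let ?p = "n + u" let ?l = "pivot V ?p"
  show u: "u \<notin> basis V" using assms(1) by (auto simp: echelon_def)
  have s: "step ?p V (n + t) (n + t) = V (n + t) (n + t) + V (n + t) ?l * V ?p (n + t)" if "t < m" for t
    using assms(3) that by (simp add: step_def pvec_def q_def)
  have "t \<in> basis (step ?p V) \<longleftrightarrow> t \<in> insert u (basis V)" if t: "t < m" for t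
  proof (cases "t = u")
    case True
    then have "V (n + t) (n + t) = 1" using u t by (auto simp: basis_def)
    then show ?thesis using s[OF t] True pivot(2)[OF assms(3)] t by (simp add: basis_def)
  next
    case False
    show ?thesis
    proof (cases "t \<in> basis V")
      case True
      then have "V (n + t) ?l = 0"
        using assms(1) pivot(1)[OF assms(3)] by (auto simp: echelon_def null_def)
      then show ?thesis using s[OF t] True by (simp add: basis_def)
    next
      case nb: False
      then have "V ?p (n + t) = 0"
        using assms(2) t \<open>t \<noteq> u\<close> by (intro echelon_tag_0[OF assms(1)]) (auto simp: q_def)
      then show ?thesis using s[OF t] nb False by (simp add: basis_def)
    qed
  qed
  then show "basis (step ?p V) = insert u (basis V)"
    using assms(2) by (auto simp: basis_def)
qed

lemma finite_basis [simp]: "finite (basis V)"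
  by (simp add: basis_def)

text \<open>The new pivot row is fresh because the pivot column vanishes on the old ones; for the
  same reason adding that column keeps the old rows zero.\<close>

lemma echelon_step:
  assumes "echelon K (n + u) V" "u < m" "K (n + u)"
  shows "echelon K (Suc (n + u)) (step (n + u) V)"
proof (cases "null V (n + u)")
  case True
  then show ?thesis using assms(1) by (force simp: echelon_def step_def)
next
  case False
  let ?p = "n + u" let ?l = "pivot V ?p" let ?V = "step ?p V"
  note b = basis_step[OF assms(1,2) False]
  have l: "?l < n" "V ?p ?l = 1" using pivot[OF False] .
  have s: "?V j i = V j i + V j ?l * V ?p i" if "i \<noteq> q" for i j
    using False that by (simp add: step_def pvec_def)
  obtain R where R: "pivotal V R" using assms(1) by (auto simp: echelon_def)
  have lR: "?l \<notin> R"
    using R l(2) assms(2) by (auto simp: pivotal_def q_def)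
  have fR: "finite R" using R by (meson pivotal_def finite_lessThan finite_subset)
  have "pivotal ?V (insert ?l R)"
    unfolding pivotal_def
  proof (intro conjI ballI)
    show "insert ?l R \<subseteq> {..<n}" using R l by (auto simp: pivotal_def)
    show "card (insert ?l R) = card (basis ?V)"
      using R b lR fR by (simp add: pivotal_def)
    fix j i assume j: "j \<in> {n..q}" and i: "i \<in> insert ?l R"
    have "i \<noteq> q" using i R l by (auto simp: pivotal_def q_def)
    then show "?V j i = 0"
      using s[of i j] i j R l assms(2) by (auto simp: pivotal_def q_def)
  qed
  moreover have "s \<in> basis ?V" if j: "j \<in> {n..q}" and "s < m" "j \<noteq> n + s" "?V j (n + s) = 1" for j s
  proof (rule ccontr)
    assume ns: "s \<notin> basis ?V"
    then have "s \<notin> basis V" "s \<noteq> u" by (auto simp: b(1))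
    then have "V j (n + s) = 0" "V ?p (n + s) = 0"
      using assms(2) that \<open>s \<noteq> u\<close> by (intro echelon_tag_0[OF assms(1)]; auto simp: q_def)+
    then show False using that s[of "n + s" j] by (simp add: q_def)
  qed
  moreover have "n + s < Suc ?p \<and> K (n + s) \<and> null ?V (n + s)" if "s \<in> basis ?V" for s
  proof (cases "s = u")
    case True
    then show ?thesis using assms(3) step_self_null by simp
  next
    case False
    then have "s \<in> basis V" using that b by auto
    then have "n + s < ?p" "K (n + s)" "null V (n + s)" using assms(1) by (auto simp: echelon_def)
    then show ?thesis by (simp add: null_def step_null)
  qed
  ultimately show ?thesis unfolding echelon_def by blast
qed

lemma echelon_mono: "echelon K k V \<Longrightarrow> k \<le> k' \<Longrightarrow> echelon K k' V"
  by (force simp: echelon_def)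

lemma run_invariants:
  assumes "\<And>p. K p \<Longrightarrow> n \<le> p" "l \<le> q"
  shows "tagged (run K l V0) \<and> echelon K l (run K l V0)"
proof (rule run_induct[of "\<lambda>k V. tagged V \<and> echelon K k V"])
  show "tagged V0 \<and> echelon K 0 V0" by (simp add: tagged_V0 echelon_V0)
next
  fix k V assume "tagged V \<and> echelon K k V"
  then show "tagged V \<and> echelon K (Suc k) V" by (auto intro: echelon_mono)
next
  fix k V assume *: "k < l" "tagged V \<and> echelon K k V" "K k"
  then obtain u where "k = n + u" "u < m"
    using assms by (metis le_Suc_ex nat_add_left_cancel_less order_less_le_trans q_def)
  then show "tagged (step k V) \<and> echelon K (Suc k) (step k V)"
    using * echelon_step tagged_step by (auto simp: q_def)
qed

subsection \<open>Choosing the terms\<close>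

definition term_flags :: "nat set \<Rightarrow> nat \<Rightarrow> bool" where
  "term_flags X p \<longleftrightarrow> n \<le> p \<and> p - n \<in> X"

text \<open>This is what shrinking preserves. Relations leave the column sum unchanged, and
  \<open>good_card\<close> turns it into a lower bound on the number of terms, so \<open>X\<close>
  never becomes too small.\<close>

definition good :: "nat \<Rightarrow> nat set \<Rightarrow> bool" where
  "good \<rho> X \<longleftrightarrow> X \<subseteq> {..<m} \<and> (\<exists>R\<subseteq>{..<n}. \<rho> \<le> card R \<and> (\<forall>i\<in>R. (\<Sum>t\<in>X. I t i) = 1))"

definition tags :: "(nat \<Rightarrow> nat \<Rightarrow> bit) \<Rightarrow> nat \<Rightarrow> nat set" where
  "tags V j = {s. s < m \<and> V j (n + s) = 1}"

lemma tags_subset_basis: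
  assumes "echelon K k V" "t < m"
  shows "tags V (n + t) - {t} \<subseteq> basis V"
proof
  fix s assume "s \<in> tags V (n + t) - {t}"
  then show "s \<in> basis V"
    using assms(2) by (intro echelon_tag[OF assms(1), of "n + t"]) (auto simp: tags_def q_def)
qed

lemma tags_sum:
  assumes "tagged V" "n \<le> j" "j \<le> q" "i < n"
  shows "V j i = of_bool (j = q) + (\<Sum>s\<in>tags V j. I s i)"
proof -
  have "{s \<in> {..<m}. V j (n + s) = 1} = tags V j" by (auto simp: tags_def)
  then show ?thesis
    using assms sum_bit_mult[of "{..<m}" "\<lambda>s. V j (n + s)" "\<lambda>s. I s i"] by (simp add: tagged_def)
qed

text \<open>The basis generates all columns, so there are at least \<open>\<rho>\<close> pivot rows.
  The reduced all-ones column is 0 on them, hence the terms tagged in it sum to 1 there.\<close>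

lemma good_initial:
  assumes rank: "\<And>B. B \<subseteq> {..<m} \<Longrightarrow> (\<forall>t<m. \<exists>T\<subseteq>B. \<forall>i<n. I t i = (\<Sum>s\<in>T. I s i)) \<Longrightarrow> \<rho> \<le> card B"
  shows "good \<rho> (tags (run (term_flags {..<m}) q V0) q)"
proof -
  let ?K = "term_flags {..<m}"
  let ?V = "run ?K q V0"
  have inv: "tagged ?V" "echelon ?K q ?V"
    using run_invariants[of ?K q] by (auto simp: term_flags_def)
  have z: "null ?V (n + t)" if "t < m" for t
    using that by (intro run_null) (auto simp: term_flags_def q_def)
  obtain R where R: "pivotal ?V R" using inv(2) by (auto simp: echelon_def)
  have "\<rho> \<le> card (basis ?V)"
  proof (rule rank)
    show "basis ?V \<subseteq> {..<m}" by (auto simp: basis_def)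
    show "\<forall>t<m. \<exists>T\<subseteq>basis ?V. \<forall>i<n. I t i = (\<Sum>s\<in>T. I s i)"
    proof (intro allI impI)
      fix t assume t: "t < m"
      show "\<exists>T\<subseteq>basis ?V. \<forall>i<n. I t i = (\<Sum>s\<in>T. I s i)"
      proof (cases "t \<in> basis ?V")
        case True
        then show ?thesis by (intro exI[of _ "{t}"]) auto
      next
        case False
        \<comment> \<open>Outside the basis, a null column still carries its own tag, so its tags
          form a relation that can be solved for \<open>t\<close>.\<close>
        let ?T = "tags ?V (n + t) - {t}"
        have tt: "t \<in> tags ?V (n + t)" using False t by (auto simp: basis_def tags_def)
        have "?T \<subseteq> basis ?V"
          using t by (intro tags_subset_basis[OF inv(2)])
        moreover have "I t i = (\<Sum>s\<in>?T. I s i)" if "i < n" for i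
        proof -
          have "0 = (\<Sum>s\<in>tags ?V (n + t). I s i)"
            using tags_sum[OF inv(1), of "n + t" i] z[OF t] that t by (simp add: null_def q_def)
          also have "\<dots> = I t i + (\<Sum>s\<in>?T. I s i)"
            using tt by (intro sum.remove) (auto simp: tags_def)
          finally show ?thesis by (cases "I t i"; cases "(\<Sum>s\<in>?T. I s i)") simp_all
        qed
        ultimately show ?thesis by blast
      qed
    qed
  qed
  moreover have "(\<Sum>s\<in>tags ?V q. I s i) = 1" if "i \<in> R" for i
  proof -
    have "i < n" "?V q i = 0" using R that by (auto simp: pivotal_def q_def)
    then show ?thesis
      using tags_sum[OF inv(1), of q i] by (cases "(\<Sum>s\<in>tags ?V q. I s i)") (auto simp: q_def)
  qed
  ultimately show ?thesis
    using R unfolding good_def pivotal_def by (auto simp: tags_def)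
qed

text \<open>The tags of a null column are a relation with sum zero, so exchanging them does not
  alter the column sum. All of them except possibly \<open>w\<close> are basis terms and lie in
  \<open>X\<close>: for \<open>w\<close> in \<open>X\<close> the whole relation is removed,
  otherwise one term is gained and at least two are lost.\<close>

lemma good_shrink:
  assumes good: "good \<rho> X" and w: "w < m"
    and V: "V = run (term_flags X) q V0" "null V (n + w)" "V (n + w) (n + w) = 1"
    and nz: "\<And>t. t < m \<Longrightarrow> \<exists>i<n. I t i = 1"
    and dist: "\<And>s t. s < m \<Longrightarrow> t < m \<Longrightarrow> s \<noteq> t \<Longrightarrow> \<exists>i<n. I s i \<noteq> I t i"
  shows "good \<rho> (sym_diff X (tags V (n + w)))" "card (sym_diff X (tags V (n + w))) < card X"
proof -
  let ?T = "tags V (n + w)"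
  have X: "X \<subseteq> {..<m}" "finite X" using good by (auto simp: good_def intro: finite_subset)
  have inv: "tagged V" "echelon (term_flags X) q V"
    using run_invariants[of "term_flags X" q] V(1) by (auto simp: term_flags_def)
  have sum0: "(\<Sum>s\<in>?T. I s i) = 0" if "i < n" for i
    using tags_sum[OF inv(1), of "n + w" i] V(2) that w by (simp add: null_def q_def)
  have fT: "finite ?T" "?T \<subseteq> {..<m}" by (auto simp: tags_def)
  show "good \<rho> (sym_diff X ?T)"
    using good fT sum_bit_sym_diff[OF X(2) fT(1)] sum0
    unfolding good_def by (smt (verit, ccfv_threshold) Diff_subset Un_subset_iff add_0_right lessThan_iff subset_iff)
  have wT: "w \<in> ?T" using V(3) w by (auto simp: tags_def)
  have bX: "basis V \<subseteq> X" using inv(2) by (auto simp: echelon_def term_flags_def)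
  have wb: "w \<notin> basis V" using V(3) by (auto simp: basis_def)
  have Tb: "?T - {w} \<subseteq> basis V"
    using w by (intro tags_subset_basis[OF inv(2)])
  show "card (sym_diff X ?T) < card X"
  proof (cases "w \<in> X")
    case True
    then have "?T \<subseteq> X" using Tb bX by auto
    then have "sym_diff X ?T = X - ?T" by auto
    then show ?thesis using True wT X(2) by (metis Diff_iff Diff_subset psubsetI psubset_card_mono)
  next
    case False
    \<comment> \<open>A relation consisting of \<open>w\<close> alone would make its column zero,
      and one with a single further term would make two columns equal.\<close>
    have "card (?T - {w}) \<noteq> 0"
    proof
      assume "card (?T - {w}) = 0"
      then have "?T - {w} = {}" using fT(1) by (simp only: card_0_eq finite_Diff)
      then have "?T = {w}" using wT by auto
      then show False using sum0 nz[OF w] by force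
    qed
    moreover have "card (?T - {w}) \<noteq> 1"
    proof
      assume "card (?T - {w}) = 1"
      then obtain s where s: "?T - {w} = {s}" by (auto simp: card_1_singleton_iff)
      then have "?T = {w, s}" "s \<noteq> w" "s < m" using wT fT(2) by auto
      then obtain i where "i < n" "I s i \<noteq> I w i" using dist w by blast
      then show False using sum0[of i] \<open>?T = {w, s}\<close> \<open>s \<noteq> w\<close>
        by (cases "I s i"; cases "I w i") auto
    qed
    ultimately have c2: "card (?T - {w}) \<ge> 2" by linarith
    have TX: "?T - {w} \<subseteq> X" using Tb bX by auto
    have "sym_diff X ?T = insert w (X - (?T - {w}))" using False TX wT by auto
    then have "card (sym_diff X ?T) = Suc (card (X - (?T - {w})))"
      using False X(2) by (simp add: card_insert_if)
    also have "\<dots> = Suc (card X - card (?T - {w}))"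
      using TX fT by (simp add: card_Diff_subset)
    also have "\<dots> < card X" using c2 card_mono[OF X(2) TX] by linarith
    finally show ?thesis .
  qed
qed

text \<open>A column that vanishes but still has its own tag exhibits a relation that shrinks the set
  of terms.\<close>

definition stable :: "(nat \<Rightarrow> nat \<Rightarrow> bit) \<Rightarrow> bool" where
  "stable V \<longleftrightarrow> (\<forall>t<m. null V (n + t) \<longrightarrow> V (n + t) (n + t) = 0)"

text \<open>A violating column is null, hence frozen, and would still violate stability after the
  step.\<close>

lemma stable_step: "stable (step p V) \<Longrightarrow> stable V"
  unfolding stable_def by (metis null_def step_null)

subsection \<open>The conditional expectation\<close>

text \<open>The expectation of the non-constant part of \<open>f\<close>, given the equations chosen so far.\<close>

definition potential :: "(nat \<Rightarrow> nat \<Rightarrow> bit) \<Rightarrow> real" where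
  "potential V = (\<Sum>t\<in>{t. t < m \<and> null V (n + t)}. c t * sg (V (n + t) q))"

text \<open>The columns that become null are exactly those equal to the pivot column on the variable
  rows. The new sign bit flips their joint contribution precisely when it is negative.\<close>

lemma potential_step:
  assumes "\<not> null V p"
  shows "potential (step p V) = potential V + \<bar>weight V p\<bar>"
proof -
  let ?l = "pivot V p" let ?V = "step p V"
  let ?Z = "{t. t < m \<and> null V (n + t)}"
  have l: "?l < n" "V p ?l = 1" using pivot[OF assms] .
  have s: "?V j i = V j i + V j ?l * pvec V p i" for i j
    using assms by (simp add: step_def)
  have sm: "?V (n + t) i = V (n + t) i + V (n + t) ?l * V p i" if "i < n" for t i
    using that s by (simp add: pvec_def q_def)
  have Z: "{t. t < m \<and> null ?V (n + t)} = ?Z \<union> same V p"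
  proof -
    have "null ?V (n + t) \<longleftrightarrow> null V (n + t) \<or> (\<forall>i<n. V (n + t) i = V p i)" for t
    proof
      assume a: "null ?V (n + t)"
      have e: "V (n + t) i = V (n + t) ?l * V p i" if "i < n" for i
        using a sm[OF that, of t] that
        by (cases "V (n + t) i"; cases "V (n + t) ?l * V p i") (auto simp: null_def)
      \<comment> \<open>The entry in the pivot row decides between the two cases: a column that
        becomes null was that entry times the pivot column.\<close>
      show "null V (n + t) \<or> (\<forall>i<n. V (n + t) i = V p i)"
        by (cases "V (n + t) ?l") (use e in \<open>auto simp: null_def\<close>)
    next
      assume "null V (n + t) \<or> (\<forall>i<n. V (n + t) i = V p i)"
      then show "null ?V (n + t)"
        using l sm[of _ t] by (auto simp: null_def)
    qed
    then show ?thesis by (auto simp: same_def)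
  qed
  have disj: "?Z \<inter> same V p = {}"
    using l by (auto simp: null_def same_def)
  have "potential ?V = (\<Sum>t\<in>?Z. c t * sg (?V (n + t) q)) + (\<Sum>t\<in>same V p. c t * sg (?V (n + t) q))"
    unfolding potential_def Z by (rule sum.union_disjoint) (use disj in \<open>auto simp: same_def\<close>)
  also have "(\<Sum>t\<in>?Z. c t * sg (?V (n + t) q)) = potential V"
    unfolding potential_def by (rule sum.cong) (auto simp: step_null)
  also have "(\<Sum>t\<in>same V p. c t * sg (?V (n + t) q))
      = (\<Sum>t\<in>same V p. c t * sg (V (n + t) q) * sg (of_bool (weight V p < 0)))"
    using l by (intro sum.cong) (auto simp: s same_def pvec_def sg_add)
  also have "\<dots> = weight V p * sg (of_bool (weight V p < 0))"
    by (simp add: weight_def sum_distrib_right)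
  also have "\<dots> = \<bar>weight V p\<bar>" by (auto simp: sg_def)
  finally show ?thesis .
qed

lemma potential_step_mono: "potential V \<le> potential (step p V)"
  by (cases "null V p") (simp_all add: potential_step, simp add: step_def)

lemma potential_run_mono: "potential V \<le> potential (run K l V)"
  by (rule run_induct[of "\<lambda>_ W. potential V \<le> potential W"])
    (auto intro: order_trans potential_step_mono)

text \<open>Stability forces \<open>same V (n + u)\<close> to be \<open>{u}\<close>: any other
  member would become null while keeping its own tag. The absolute weight is then a single absolute
  coefficient, without cancellation.\<close>

lemma potential_stable_step:
  assumes "echelon K (n + u) V" "u < m" "stable (step (n + u) V)"
  shows "potential (step (n + u) V) = potential V + \<bar>c u\<bar>"
proof -
  let ?p = "n + u" let ?V = "step ?p V"
  have st: "stable V" using assms(3) by (rule stable_step)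
  have ub: "u \<notin> basis V" using assms(1) by (auto simp: echelon_def)
  then have nn: "\<not> null V ?p" using st assms(2) by (auto simp: stable_def basis_def)
  have "same V ?p = {u}"
  proof (rule ccontr)
    assume "same V ?p \<noteq> {u}"
    then obtain t where t: "t < m" "t \<noteq> u" "\<forall>i<n. V (n + t) i = V ?p i"
      using assms(2) by (auto simp: same_def)
    have tb: "t \<notin> basis V" using nn t(3) assms(1) by (auto simp: echelon_def null_def)
    then have "t \<notin> basis ?V" using basis_step[OF assms(1,2) nn] t by simp
    moreover have "null ?V (n + t)"
      using t(3) pivot[OF nn] nn by (auto simp: null_def step_def pvec_def q_def)
    ultimately show False using assms(3) t(1) by (auto simp: stable_def basis_def)
  qed
  then have "\<bar>weight V ?p\<bar> = \<bar>c u\<bar>" by (auto simp: weight_def sg_def)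
  then show ?thesis using potential_step[OF nn] by simp
qed

lemma potential_V0:
  assumes "\<And>t. t < m \<Longrightarrow> \<exists>i<n. I t i = 1"
  shows "potential V0 = 0"
proof -
  have "{t. t < m \<and> null V0 (n + t)} = {}"
    using assms by (fastforce simp: null_def V0_def q_def)
  then show ?thesis by (simp only: potential_def sum.empty)
qed

lemma potential_stable_run:
  assumes X: "X \<subseteq> {..<m}" and st: "stable (run (term_flags X) q V0)"
    and nz: "\<And>t. t < m \<Longrightarrow> \<exists>i<n. I t i = 1"
  shows "potential (run (term_flags X) q V0) = (\<Sum>t\<in>X. \<bar>c t\<bar>)"
proof -
  let ?K = "term_flags X"
  have fX: "finite X" using X finite_subset by blast
  \<comment> \<open>Stability at the end passes backwards to every prefix of the run.\<close>
  have st': "stable (run ?K l V0)" if "l \<le> q" for l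
    using that
  proof (induction rule: inc_induct)
    case (step l)
    then show ?case using stable_step by (auto split: if_splits)
  qed (rule st)
  have "l \<le> q \<Longrightarrow> potential (run ?K l V0) = (\<Sum>t\<in>{t\<in>X. n + t < l}. \<bar>c t\<bar>)" for l
  proof (induction l)
    case (Suc l)
    show ?case
    proof (cases "?K l")
      case True
      then obtain u where u: "l = n + u" "u \<in> X"
        by (auto simp: term_flags_def le_iff_add)
      have "echelon ?K l (run ?K l V0)"
        using run_invariants[of ?K l] Suc.prems by (auto simp: term_flags_def)
      then have "potential (run ?K (Suc l) V0) = potential (run ?K l V0) + \<bar>c u\<bar>"
        using potential_stable_step[of ?K u] st'[of "Suc l"] True u Suc.prems X by (auto simp: q_def)
      moreover have "{t\<in>X. n + t < Suc l} = insert u {t\<in>X. n + t < l}" using u by auto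
      ultimately show ?thesis using Suc u fX by simp
    next
      case False
      then have "{t\<in>X. n + t < Suc l} = {t\<in>X. n + t < l}"
        by (auto simp: term_flags_def less_Suc_eq)
      then show ?thesis using False Suc by simp
    qed
  qed (simp add: potential_V0[OF nz])
  moreover have "{t\<in>X. n + t < q} = X" using X by (auto simp: q_def)
  ultimately show ?thesis by simp
qed

text \<open>The second run fixes the remaining characters, those of single variables included,
  without lowering the potential. Then every term is null, and the potential is the non-constant
  part of the function at the point read off the sign bits of the variables.\<close>

lemma final_value:
  assumes X: "X \<subseteq> {..<m}" and st: "stable (run (term_flags X) q V0)"
    and nz: "\<And>t. t < m \<Longrightarrow> \<exists>i<n. I t i = 1"
    and V: "V = run (\<lambda>_. True) q (run (term_flags X) q V0)"
  shows "(\<Sum>t\<in>X. \<bar>c t\<bar>) \<le> (\<Sum>t<m. c t * sg (\<Sum>k<n. I t k * V k q))"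
proof -
  have "(\<Sum>t\<in>X. \<bar>c t\<bar>) \<le> potential V"
    using potential_run_mono[of "run (term_flags X) q V0"] by (simp add: V potential_stable_run[OF X st nz])
  also have "{t. t < m \<and> null V (n + t)} = {..<m}"
    by (auto simp: V q_def intro: run_null)
  then have "potential V = (\<Sum>t<m. c t * sg (V (n + t) q))"
    by (simp add: potential_def)
  also have "\<dots> = (\<Sum>t<m. c t * sg (\<Sum>k<n. I t k * V k q))"
    using linear_run[OF linear_run[OF linear_V0]] by (intro sum.cong) (auto simp: V linear_def)
  finally show ?thesis .
qed

text \<open>A row where the column sum is 1 meets some term of \<open>X\<close>, and each term
  covers at most \<open>r\<close> rows.\<close>

lemma good_card:
  assumes "good \<rho> X" "\<And>t. t < m \<Longrightarrow> card {i. i < n \<and> I t i = 1} \<le> r"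
  shows "\<rho> \<le> r * card X"
proof -
  obtain R where R: "R \<subseteq> {..<n}" "\<rho> \<le> card R" "\<forall>i\<in>R. (\<Sum>t\<in>X. I t i) = 1" and X: "X \<subseteq> {..<m}"
    using assms(1) by (auto simp: good_def)
  have fX: "finite X" using X finite_subset by blast
  have "R \<subseteq> (\<Union>t\<in>X. {i. i < n \<and> I t i = 1})"
  proof
    fix i assume i: "i \<in> R"
    then have "(\<Sum>t\<in>X. I t i) \<noteq> 0" using R(3) by simp
    then obtain t where "t \<in> X" "I t i \<noteq> 0" by (meson sum.neutral)
    then show "i \<in> (\<Union>t\<in>X. {i. i < n \<and> I t i = 1})" using i R(1) by auto
  qed
  then have "card R \<le> card (\<Union>t\<in>X. {i. i < n \<and> I t i = 1})"
    using fX by (intro card_mono) auto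
  also have "\<dots> \<le> (\<Sum>t\<in>X. card {i. i < n \<and> I t i = 1})" by (rule card_UN_le[OF fX])
  also have "\<dots> \<le> (\<Sum>t\<in>X. r)" using X assms(2) by (intro sum_mono) auto
  finally show ?thesis using R(2) by (simp add: mult.commute)
qed

end

section \<open>The rank of the term matrix\<close>

text \<open>\<open>S\<close> spans the column space, so its cardinality bounds the dimension.
  \<open>span_li_not_depend\<close> transfers spanning from the ambient space to the subspace, where
  \<open>gen_ge_dim\<close> applies.\<close>

lemma (in vec_space) rank_le_card_generating:
  assumes A: "A \<in> carrier_mat n nc" and S: "S \<subseteq> carrier_vec n" "finite S"
    and gen: "set (cols A) \<subseteq> span S" "S \<subseteq> set (cols A)"
  shows "rank A \<le> card S"
proof -
  have cols: "set (cols A) \<subseteq> carrier_vec n" using A cols_dim by blast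
  have eq: "span (set (cols A)) = span S"
    using gen S cols by (meson span_is_monotone span_is_submodule span_is_subset subset_antisym)
  have sub: "submodule class_ring (span S) V" by (rule span_is_submodule[OF S(1)])
  have SS: "S \<subseteq> span S" by (rule in_own_span[OF S(1)])
  have vs: "vectorspace class_ring (span_vs S)"
    unfolding vectorspace_def using submodule_is_module[OF sub] field.field_axioms by blast
  have g: "LinearCombinations.module.span class_ring (span_vs S) S = carrier (span_vs S)"
    using span_li_not_depend(1)[OF SS sub] by simp
  have "vectorspace.dim class_ring (span_vs S) \<le> card S"
    by (rule vectorspace.gen_ge_dim[OF vs S(2) _ g]) (simp add: SS)
  then show ?thesis by (simp add: rank_def eq)
qed

lemma term_matrix_carrier: "term_matrix n Is \<in> carrier_mat n (length Is)"
  by (simp add: term_matrix_def)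

lemma col_term_matrix:
  "s < length Is \<Longrightarrow> col (term_matrix n Is) s = vec n (\<lambda>i. of_bool (i \<in> Is ! s))"
  by (rule eq_vecI) (auto simp: term_matrix_def)

lemma set_cols_term_matrix: "set (cols (term_matrix n Is)) = col (term_matrix n Is) ` {..<length Is}"
  by (simp add: cols_def term_matrix_def lessThan_atLeast0)

text \<open>Provides the hypothesis \<open>rank\<close> of \<open>good_initial\<close>, in which the
  rank enters only as a lower bound for generating sets of columns.\<close>

lemma rank_F2_le_card:
  assumes B: "B \<subseteq> {..<length Is}"
    and gen: "\<forall>t<length Is. \<exists>T\<subseteq>B. \<forall>i<n. of_bool (i \<in> Is ! t) = (\<Sum>s\<in>T. of_bool (i \<in> Is ! s) :: bit)"
  shows "rank_F2 n Is \<le> card B"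
proof -
  let ?A = "term_matrix n Is"
  interpret vec_space "TYPE(bit)" n .
  note A = term_matrix_carrier[of n Is]
  have fB: "finite B" using B finite_subset by blast
  let ?S = "col ?A ` B"
  have S: "?S \<subseteq> carrier_vec n"
    using col_dim[of ?A] carrier_matD(1)[OF A] by fastforce
  note col = col_term_matrix[of _ Is n]
  have sums: "vec n (\<lambda>i. \<Sum>s\<in>T. of_bool (i \<in> Is ! s)) \<in> span ?S" if "T \<subseteq> B" for T
    using finite_subset[OF that fB] that
  proof (induction T rule: finite_induct)
    case empty
    have "vec n (\<lambda>i. \<Sum>s\<in>{}. of_bool (i \<in> Is ! s)) = (0\<^sub>v n :: bit vec)" by auto
    then show ?case using vectorspace.span_zero[OF vectorspace_axioms, of ?S] by (simp only: module_vec_simps)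
  next
    case (insert s T)
    have "vec n (\<lambda>i. \<Sum>s\<in>insert s T. of_bool (i \<in> Is ! s))
        = col ?A s + vec n (\<lambda>i. \<Sum>s\<in>T. of_bool (i \<in> Is ! s))"
      using insert B by (intro eq_vecI) (auto simp: col)
    moreover have "col ?A s \<in> span ?S" by (rule span_mem[OF S]) (use insert in blast)
    ultimately show ?case using insert span_add1[OF S, of "col ?A s"] by (simp add: module_vec_simps)
  qed
  have "rank ?A \<le> card ?S"
  proof (rule rank_le_card_generating[OF A S])
    show "set (cols ?A) \<subseteq> span ?S"
    proof
      fix v assume "v \<in> set (cols ?A)"
      then obtain t where t: "t < length Is" "v = col ?A t"
        unfolding set_cols_term_matrix by blast
      then obtain T where T: "T \<subseteq> B" "\<forall>i<n. of_bool (i \<in> Is ! t) = (\<Sum>s\<in>T. of_bool (i \<in> Is ! s) :: bit)"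
        using gen by blast
      have "v = vec n (\<lambda>i. \<Sum>s\<in>T. of_bool (i \<in> Is ! s))"
        unfolding t(2) col[OF t(1)] using T(2) by (intro eq_vecI) auto
      then show "v \<in> span ?S" using sums[OF T(1)] by simp
    qed
    show "?S \<subseteq> set (cols ?A)" unfolding set_cols_term_matrix using B by blast
  qed (use fB in auto)
  also have "\<dots> \<le> card B" by (rule card_image_le[OF fB])
  finally show ?thesis by (simp add: rank_F2_def)
qed

section \<open>The algorithm\<close>

abbreviation entry :: "nexp \<Rightarrow> nexp \<Rightarrow> nexp" where
  "entry j i \<equiv> NCell ''W'' (NAdd (NCell ''o'' j) i)"

abbreviation set_entry :: "nexp \<Rightarrow> nexp \<Rightarrow> nexp \<Rightarrow> com" where
  "set_entry j i e \<equiv> NAssign ''W'' (NAdd (NCell ''o'' j) i) e"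

abbreviation set_var :: "vname \<Rightarrow> nexp \<Rightarrow> com" where
  "set_var v e \<equiv> NAssign v (NConst 0) e"

abbreviation eq_test :: "nexp \<Rightarrow> nexp \<Rightarrow> bexp" where
  "eq_test e1 e2 \<equiv> BAnd (BNot (NLess e1 e2)) (BNot (NLess e2 e1))"

abbreviation pos_test :: "nexp \<Rightarrow> bexp" where
  "pos_test e \<equiv> NLess (NConst 0) e"

text \<open>With truncated subtraction this is the distance of two numbers, which is exclusive or on
  0 and 1.\<close>

abbreviation xor_exp :: "nexp \<Rightarrow> nexp \<Rightarrow> nexp" where
  "xor_exp e1 e2 \<equiv> NAdd (NSub e1 e2) (NSub e2 e1)"

abbreviation term_col :: nexp where
  "term_col \<equiv> NAdd (cell ''n'') (cell ''t'')"

text \<open>Array \<open>W\<close> is the working matrix, with the column offsets in \<open>o\<close>; \<open>a\<close> holds the column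
  offsets of the input matrix, and \<open>K\<close> flags the columns to be processed.\<close>

definition init_prog :: com where
  "init_prog = For ''j'' ''N'' (For ''i'' ''N''
    (Cond (eq_test (cell ''i'') (cell ''j'')) (set_entry (cell ''j'') (cell ''i'') (NConst 1))
    (Cond (NLess (cell ''i'') (cell ''n''))
      (Cond (NLess (cell ''j'') (cell ''n'')) (set_entry (cell ''j'') (cell ''i'') (NConst 0))
      (Cond (NLess (cell ''j'') (cell ''q''))
        (set_entry (cell ''j'') (cell ''i'')
          (NCell ''A'' (NAdd (NCell ''a'' (NSub (cell ''j'') (cell ''n''))) (cell ''i''))))
        (set_entry (cell ''j'') (cell ''i'') (NConst 1))))
      (set_entry (cell ''j'') (cell ''i'') (NConst 0)))))"

text \<open>The value \<open>q\<close> stands for "no pivot"; a genuine pivot is below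
  \<open>n\<close>, hence below \<open>q\<close>.\<close>

definition pivot_prog :: com where
  "pivot_prog = Seq (set_var ''l'' (cell ''q''))
    (For ''i'' ''n'' (Cond (pos_test (entry (cell ''p'') (cell ''i''))) (set_var ''l'' (cell ''i'')) Skip))"

definition weight_prog :: com where
  "weight_prog = Seq (RAssign ''S'' (NConst 0) RZero) (For ''t'' ''m''
    (Seq (set_var ''e'' (NConst 0))
    (Seq (For ''i'' ''n'' (Cond (eq_test (entry (cell ''p'') (cell ''i'')) (entry term_col (cell ''i'')))
        Skip (set_var ''e'' (NConst 1))))
    (Cond (pos_test (cell ''e'')) Skip
    (Cond (pos_test (entry term_col (cell ''q'')))
      (RAssign ''S'' (NConst 0) (RSub (RCell ''S'' (NConst 0)) (RCell ''coeff'' (cell ''t''))))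
      (RAssign ''S'' (NConst 0) (RAdd (RCell ''S'' (NConst 0)) (RCell ''coeff'' (cell ''t'')))))))))"

text \<open>The pivot column is copied to \<open>v\<close> because elimination overwrites it in
  place.\<close>

definition pvec_prog :: com where
  "pvec_prog = Seq (For ''i'' ''N'' (NAssign ''v'' (cell ''i'') (entry (cell ''p'') (cell ''i''))))
    (Cond (RLess (RCell ''S'' (NConst 0)) RZero)
      (NAssign ''v'' (cell ''q'') (NConst 1)) (NAssign ''v'' (cell ''q'') (NConst 0)))"

definition elim_prog :: com where
  "elim_prog = For ''j'' ''N'' (Cond (pos_test (entry (cell ''j'') (cell ''l'')))
    (For ''i'' ''N'' (set_entry (cell ''j'') (cell ''i'')
      (xor_exp (entry (cell ''j'') (cell ''i'')) (NCell ''v'' (cell ''i''))))) Skip)"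

definition step_prog :: com where
  "step_prog = Seq pivot_prog (Cond (NLess (cell ''l'') (cell ''q''))
    (Seq weight_prog (Seq pvec_prog elim_prog)) Skip)"

definition run_prog :: com where
  "run_prog = For ''p'' ''q'' (Cond (pos_test (NCell ''K'' (cell ''p''))) step_prog Skip)"

text \<open>The value \<open>q\<close> of \<open>w\<close> signals that no relation exists; it is
  never the index of a term column.\<close>

definition search_prog :: com where
  "search_prog = Seq (set_var ''w'' (cell ''q'')) (For ''t'' ''m''
    (Seq (set_var ''e'' (NConst 0))
    (Seq (For ''i'' ''n'' (Cond (pos_test (entry term_col (cell ''i''))) (set_var ''e'' (NConst 1)) Skip))
    (Cond (BAnd (BNot (pos_test (cell ''e''))) (pos_test (entry term_col term_col)))
      (set_var ''w'' term_col) Skip))))"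

definition copy_prog :: com where
  "copy_prog = For ''t'' ''m'' (NAssign ''K'' term_col (entry (cell ''q'') term_col))"

definition update_prog :: com where
  "update_prog = For ''t'' ''m''
    (NAssign ''K'' term_col (xor_exp (NCell ''K'' term_col) (entry (cell ''w'') term_col)))"

text \<open>A fixed number of rounds, idle once no relation is left, replaces a loop until stability
  and so fits \<open>wp_For\<close>.\<close>

definition shrink_prog :: com where
  "shrink_prog = For ''r'' ''N'' (Seq init_prog (Seq run_prog (Seq search_prog
    (Cond (NLess (cell ''w'') (cell ''q'')) update_prog Skip))))"

text \<open>Multiples of the column lengths are tabulated by repeated addition, since the machine
  cannot multiply.\<close>

definition setup_prog :: com where
  "setup_prog = Seq (set_var ''q'' (NAdd (cell ''n'') (cell ''m'')))
    (Seq (set_var ''N'' (NAdd (cell ''q'') (NConst 1)))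
    (Seq (For ''j'' ''N'' (Seq (NAssign ''o'' (cell ''j'') (cell ''c''))
      (set_var ''c'' (NAdd (cell ''c'') (cell ''N'')))))
    (Seq (For ''t'' ''m'' (Seq (NAssign ''a'' (cell ''t'') (cell ''d''))
      (set_var ''d'' (NAdd (cell ''d'') (cell ''n'')))))
    (For ''t'' ''m'' (NAssign ''K'' term_col (NConst 1))))))"

text \<open>The matrix is rebuilt after \<open>shrink_prog\<close>, whose loop invariant speaks of
  the chosen terms only.\<close>

definition algorithm :: com where
  "algorithm = Seq setup_prog (Seq init_prog (Seq run_prog (Seq copy_prog (Seq shrink_prog
    (Seq init_prog (Seq run_prog (Seq (For ''j'' ''q'' (NAssign ''K'' (cell ''j'') (NConst 1)))
    (Seq run_prog (For ''i'' ''n'' (NAssign ''x'' (cell ''i'') (entry (cell ''i'') (cell ''q''))))))))))))"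

section \<open>Write sets of the programs\<close>

lemma writes_prog [simp]:
  "nat_writes init_prog = {''j'', ''i'', ''W''}" "real_writes init_prog = {}"
  "nat_writes pivot_prog = {''l'', ''i''}" "real_writes pivot_prog = {}"
  "nat_writes weight_prog = {''t'', ''e'', ''i''}" "real_writes weight_prog = {''S''}"
  "nat_writes pvec_prog = {''i'', ''v''}" "real_writes pvec_prog = {}"
  "nat_writes elim_prog = {''j'', ''i'', ''W''}" "real_writes elim_prog = {}"
  by (auto simp: init_prog_def pivot_prog_def weight_prog_def pvec_prog_def elim_prog_def)

lemma writes_step_prog [simp]:
  "nat_writes step_prog = {''l'', ''i'', ''t'', ''e'', ''v'', ''j'', ''W''}" "real_writes step_prog = {''S''}"
  by (auto simp: step_prog_def)

lemma writes_run_prog [simp]: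
  "nat_writes run_prog = {''p'', ''l'', ''i'', ''t'', ''e'', ''v'', ''j'', ''W''}"
  "real_writes run_prog = {''S''}"
  by (auto simp: run_prog_def)

lemma writes_search_prog [simp]:
  "nat_writes search_prog = {''w'', ''t'', ''e'', ''i''}" "real_writes search_prog = {}"
  "nat_writes copy_prog = {''t'', ''K''}" "real_writes copy_prog = {}"
  "nat_writes update_prog = {''t'', ''K''}" "real_writes update_prog = {}"
  by (auto simp: search_prog_def copy_prog_def update_prog_def)

lemma writes_shrink_prog [simp]:
  "nat_writes shrink_prog = {''r'', ''p'', ''l'', ''i'', ''t'', ''e'', ''v'', ''j'', ''W'', ''w'', ''K''}"
  "real_writes shrink_prog = {''S''}"
  by (auto simp: shrink_prog_def)

section \<open>Representation of bits and of the working matrix in memory\<close>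

definition nb :: "bit \<Rightarrow> nat" where
  "nb b = (if b = 1 then 1 else 0)"

lemma nb_simps [simp]: "nb 0 = 0" "nb 1 = 1" "0 < nb b \<longleftrightarrow> b = 1" "nb a = nb b \<longleftrightarrow> a = b"
  "nb (of_bool P) = of_bool P"
  by (cases a; cases b; auto simp: nb_def)+

lemma nb_eq_iff: "\<not> nb a < nb b \<and> \<not> nb b < nb a \<longleftrightarrow> a = b"
  by (cases a; cases b; auto simp: nb_def)

lemma nb_xor: "(nb a - nb b) + (nb b - nb a) = nb (a + b)"
  by (cases a; cases b) (simp_all add: nb_def)

lemma frame_nats: "frame c s s' \<Longrightarrow> u \<notin> nat_writes c \<Longrightarrow> nats s' u = nats s u"
  by (simp add: frame_def)

lemma frame_reals: "frame c s s' \<Longrightarrow> u \<notin> real_writes c \<Longrightarrow> reals s' u = reals s u"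
  by (simp add: frame_def)

lemma Max_less_Suc: "P k \<Longrightarrow> Max {i. i < Suc k \<and> P i} = (k::nat)"
  by (rule Max_eqI) auto

context term_system
begin

definition off :: "nat \<Rightarrow> nat" where
  "off j = j * Suc q"

lemma off_div: "i \<le> q \<Longrightarrow> (off j + i) div Suc q = j"
  unfolding off_def by (subst div_mult_self3) simp_all

lemma off_eq_iff [simp]:
  assumes "i \<le> q" "i' \<le> q"
  shows "off j + i = off j' + i' \<longleftrightarrow> j = j' \<and> i = i'"
proof
  assume *: "off j + i = off j' + i'"
  have "off j + i = off j' + i'" using * .
  then have "j = j'" using off_div[OF assms(1), of j] off_div[OF assms(2), of j'] by metis
  then show "j = j' \<and> i = i'" using * by simp
qed auto

lemma off_inj [simp]: "off j = off j' \<longleftrightarrow> j = j'"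
  using off_eq_iff[of 0 0 j j'] by simp

text \<open>Gathers what is fixed once setup is done; each later program preserves it by its write
  set alone.\<close>

definition env :: "state \<Rightarrow> bool" where
  "env s \<longleftrightarrow> nats s ''n'' 0 = n \<and> nats s ''m'' 0 = m \<and> nats s ''q'' 0 = q \<and> nats s ''N'' 0 = Suc q \<and>
    (\<forall>j\<le>q. nats s ''o'' j = off j) \<and> (\<forall>t<m. nats s ''a'' t = t * n) \<and>
    (\<forall>t<m. \<forall>i<n. nats s ''A'' (t * n + i) = nb (I t i)) \<and>
    (\<forall>t<m. reals s ''coeff'' t = c t)"

definition repr :: "(nat \<Rightarrow> nat \<Rightarrow> bit) \<Rightarrow> state \<Rightarrow> bool" where
  "repr V s \<longleftrightarrow> (\<forall>j\<le>q. \<forall>i\<le>q. nats s ''W'' (off j + i) = nb (V j i))"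

lemma env_frame:
  assumes "env s" "frame p s s'"
    "{''n'', ''m'', ''q'', ''N'', ''o'', ''a'', ''A''} \<inter> nat_writes p = {}" "''coeff'' \<notin> real_writes p"
  shows "env s'"
  using assms(1,3,4) frame_nats[OF assms(2)] frame_reals[OF assms(2)] by (simp add: env_def)

lemma repr_frame: "repr V s \<Longrightarrow> frame p s s' \<Longrightarrow> ''W'' \<notin> nat_writes p \<Longrightarrow> repr V s'"
  by (simp add: repr_def frame_nats)

lemma envD:
  assumes "env s"
  shows "nats s ''n'' 0 = n" "nats s ''m'' 0 = m" "nats s ''q'' 0 = q" "nats s ''N'' 0 = Suc q"
    "j \<le> q \<Longrightarrow> nats s ''o'' j = off j" "t < m \<Longrightarrow> nats s ''a'' t = t * n"
    "t < m \<Longrightarrow> i < n \<Longrightarrow> nats s ''A'' (t * n + i) = nb (I t i)" "t < m \<Longrightarrow> reals s ''coeff'' t = c t"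
  using assms by (auto simp: env_def)

lemma reprD: "repr V s \<Longrightarrow> j \<le> q \<Longrightarrow> i \<le> q \<Longrightarrow> nats s ''W'' (off j + i) = nb (V j i)"
  by (simp add: repr_def)

lemma repr_write:
  assumes "repr V s" "j \<le> q" "i \<le> q" "x = nb (V' j i)"
    "\<And>j' i'. j' \<le> q \<Longrightarrow> i' \<le> q \<Longrightarrow> \<not> (j' = j \<and> i' = i) \<Longrightarrow> V' j' i' = V j' i'"
  shows "repr V' (write_nat ''W'' (off j + i) x s)"
  using assms by (auto simp: repr_def)

lemma repr_other [simp]:
  "v \<noteq> ''W'' \<Longrightarrow> repr V (write_nat v i x s) = repr V s"
  "repr V (write_real u i y s) = repr V s"
  by (simp_all add: repr_def)

lemma env_cong:
  assumes "\<And>u. u \<in> {''n'', ''m'', ''q'', ''N'', ''o'', ''a'', ''A''} \<Longrightarrow> nats s' u = nats s u"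
    "reals s' ''coeff'' = reals s ''coeff''"
  shows "env s' = env s"
  unfolding env_def by (simp only: assms insert_iff simp_thms)

lemma env_other [simp]:
  "v \<notin> {''n'', ''m'', ''q'', ''N'', ''o'', ''a'', ''A''} \<Longrightarrow> env (write_nat v i x s) = env s"
  "u \<noteq> ''coeff'' \<Longrightarrow> env (write_real u i y s) = env s"
  by (rule env_cong; auto)+

lemma n_le_q: "n \<le> q" by (simp add: q_def)

section \<open>Correctness of building the matrix and of one elimination step\<close>

lemma wp_init_prog:
  assumes env: "env s" and N: "Suc q \<le> N"
  shows "wp N init_prog (repr V0) s"
  unfolding init_prog_def
proof (rule wp_For[where K = "Suc q" and
    Inv = "\<lambda>k s. \<forall>j\<le>q. \<forall>i\<le>q. j < k \<longrightarrow> nats s ''W'' (off j + i) = nb (V0 j i)"], goal_cases)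
  case (8 k s')
  note k = 8(1) note Inv = 8(2) note j = 8(3)
  have env': "env s'" by (rule env_frame[OF env 8(4)]) simp_all
  show ?case
  proof (rule wp_For[where K = "Suc q" and Inv = "\<lambda>l s. \<forall>j\<le>q. \<forall>i\<le>q. j < k \<or> j = k \<and> i < l \<longrightarrow>
      nats s ''W'' (off j + i) = nb (V0 j i)"], goal_cases)
    case (8 l s'')
    note l = 8(1) note Inv' = 8(2)
    have env'': "env s''" by (rule env_frame[OF env' 8(4)]) simp_all
    have jl: "nats s'' ''j'' 0 = k" "nats s'' ''i'' 0 = l"
      using frame_nats[OF 8(4), of "''j''"] j 8(3) by simp_all
    let ?P = "\<lambda>s. \<forall>j\<le>q. \<forall>i\<le>q. j < k \<or> j = k \<and> i < Suc l \<longrightarrow> nats s ''W'' (off j + i) = nb (V0 j i)"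
    \<comment> \<open>Every leaf of the nested conditional writes this one cell, so only the written
      value has to be checked.\<close>
    have upd: "?P (write_nat ''W'' a x s'')" if "a = off k + l" "x = nb (V0 k l)" for a x
      using Inv' that k l by (auto simp: less_Suc_eq)
    have kq: "k \<le> q" "l \<le> q" "\<not> k < n \<Longrightarrow> k < q \<Longrightarrow> k - n < m" using k l by (auto simp: q_def)
    show ?case
      by (intro wp_Cond wp_NAssign upd) (use kq n_le_q in \<open>auto simp: V0_def envD[OF env''] jl\<close>)
  next
    case (9 s'')
    then show ?case by (auto simp: less_Suc_eq_le le_less)
  qed (use envD[OF env'] Inv N in simp_all)
next
  case (9 s')
  then show ?case by (simp add: repr_def)
qed (use envD[OF env] N in simp_all)

lemma repr_cong: "repr V s \<Longrightarrow> (\<And>j i. j \<le> q \<Longrightarrow> i \<le> q \<Longrightarrow> V' j i = V j i) \<Longrightarrow> repr V' s"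
  by (simp add: repr_def)

lemma wp_pivot_prog:
  assumes env: "env s" and V: "repr V s" and p: "nats s ''p'' 0 = p" "p \<le> q" and N: "Suc q \<le> N"
  shows "wp N pivot_prog (\<lambda>s'. nats s' ''l'' 0 = (if null V p then q else pivot V p)) s"
  unfolding pivot_prog_def
proof (intro wp_Seq wp_NAssign, rule wp_For[where K = n and
    Inv = "\<lambda>k s. nats s ''l'' 0 = (if \<exists>i<k. V p i = 1 then Max {i. i < k \<and> V p i = 1} else q)"], goal_cases)
  case (8 k s')
  have env': "env s'" by (rule env_frame[OF _ 8(4)]) (simp_all add: env)
  have V': "repr V s'" by (rule repr_frame[OF _ 8(4)]) (simp_all add: V)
  have vars: "nats s' ''p'' 0 = p" "nats s' ''i'' 0 = k"
    using frame_nats[OF 8(4), of "''p''"] 8(3) p by simp_all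
  have "k \<le> q" using 8(1) n_le_q by simp
  then have W: "nats s' ''W'' (off p + k) = nb (V p k)" using reprD[OF V' p(2)] by simp
  show ?case
  proof (intro wp_Cond wp_NAssign wp_Skip, goal_cases)
    case 1
    then have "V p k = 1" by (simp add: vars envD(5)[OF env' p(2)] W)
    then show ?case by (auto simp: vars Max_less_Suc)
  next
    case 2
    then have "V p k = 0" by (simp add: vars envD(5)[OF env' p(2)] W)
    then have eq: "(i < Suc k \<and> V p i = 1) = (i < k \<and> V p i = 1)" for i by (auto simp: less_Suc_eq)
    show ?case unfolding eq by (rule 8(2))
  qed
next
  case (9 s')
  then show ?case by (auto simp: null_def pivot_def)
qed (use envD[OF env] N n_le_q in simp_all)

lemma wp_same_test:
  assumes env: "env s" and V: "repr V s" and p: "nats s ''p'' 0 = p" "p \<le> q" and N: "Suc q \<le> N"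
    and t: "nats s ''t'' 0 = t" "t < m" and e: "nats s ''e'' 0 = 0"
  shows "wp N (For ''i'' ''n'' (Cond (eq_test (entry (cell ''p'') (cell ''i'')) (entry term_col (cell ''i'')))
        Skip (set_var ''e'' (NConst 1)))) (\<lambda>s'. nats s' ''e'' 0 = of_bool (t \<notin> same V p)) s"
proof (rule wp_For[where K = n and
    Inv = "\<lambda>k s. nats s ''e'' 0 = of_bool (\<exists>i<k. V (n + t) i \<noteq> V p i)"], goal_cases)
  case (8 k s')
  have env': "env s'" by (rule env_frame[OF _ 8(4)]) (simp_all add: env)
  have V': "repr V s'" by (rule repr_frame[OF _ 8(4)]) (simp_all add: V)
  have vars: "nats s' ''p'' 0 = p" "nats s' ''i'' 0 = k" "nats s' ''t'' 0 = t"
    using frame_nats[OF 8(4), of "''p''"] frame_nats[OF 8(4), of "''t''"] 8(3) p t by simp_all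
  have le: "k \<le> q" "n + t \<le> q" using 8(1) t(2) by (simp_all add: q_def)
  have W: "nats s' ''W'' (off p + k) = nb (V p k)" "nats s' ''W'' (off (n + t) + k) = nb (V (n + t) k)"
    using reprD[OF V'] p(2) le by simp_all
  have b: "bval (eq_test (entry (cell ''p'') (cell ''i'')) (entry term_col (cell ''i''))) s' \<longleftrightarrow> V (n + t) k = V p k"
    by (simp only: bval.simps nval.simps vars envD(1,5)[OF env'] p(2) le W nb_eq_iff) auto
  show ?case
    using 8(2) by (intro wp_Cond wp_NAssign wp_Skip; simp only: b) (auto simp: less_Suc_eq)
next
  case (9 s')
  then show ?case using t by (simp add: same_def)
qed (use envD[OF env] N n_le_q e in simp_all)

lemma wp_weight_prog:
  assumes env: "env s" and V: "repr V s" and p: "nats s ''p'' 0 = p" "p \<le> q" and N: "Suc q \<le> N"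
  shows "wp N weight_prog (\<lambda>s'. reals s' ''S'' 0 = weight V p) s"
  unfolding weight_prog_def
proof (intro wp_Seq wp_RAssign, rule wp_For[where K = m and
    Inv = "\<lambda>k s. reals s ''S'' 0 = (\<Sum>t\<in>{t\<in>same V p. t < k}. c t * sg (V (n + t) q))"], goal_cases)
  case (8 k s')
  note k = 8(1) note Inv = 8(2)
  have env': "env s'" by (rule env_frame[OF _ 8(4)]) (simp_all add: env)
  have V': "repr V s'" by (rule repr_frame[OF _ 8(4)]) (simp_all add: V)
  have vars: "nats s' ''p'' 0 = p" "nats s' ''t'' 0 = k"
    using frame_nats[OF 8(4), of "''p''"] 8(3) p by simp_all
  have nk: "n + k \<le> q" using k by (simp add: q_def)
  have fin: "finite {t \<in> same V p. t < k}" by simp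
  have Suc: "{t \<in> same V p. t < Suc k} = (if k \<in> same V p then insert k else id) {t \<in> same V p. t < k}"
    by (auto simp: less_Suc_eq)
  show ?case
  proof (intro wp_Seq wp_NAssign, rule wp_conseq, rule wp_same_test[of _ V p N k], goal_cases)
    \<comment> \<open>The first eight cases are the hypotheses of \<open>wp_same_test\<close>; this
      one continues after the inner loop.\<close>
    case (9 s'')
    have env'': "env s''" by (rule env_frame[OF _ 9(1)]) (simp_all add: env')
    have V'': "repr V s''" by (rule repr_frame[OF _ 9(1)]) (simp_all add: V')
    have t: "nats s'' ''t'' 0 = k"
      using frame_nats[OF 9(1), of "''t''"] vars by simp
    have S: "reals s'' ''S'' 0 = (\<Sum>t\<in>{t\<in>same V p. t < k}. c t * sg (V (n + t) q))"
      using frame_reals[OF 9(1), of "''S''"] Inv by simp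
    have W: "nats s'' ''W'' (off (n + k) + q) = nb (V (n + k) q)"
      using reprD[OF V'' nk] by simp
    have b: "bval (pos_test (cell ''e'')) s'' \<longleftrightarrow> k \<notin> same V p"
      using 9(2) by simp
    have b': "bval (pos_test (entry term_col (cell ''q''))) s'' \<longleftrightarrow> V (n + k) q = 1"
      by (simp add: t envD[OF env''] nk W)
    show ?case
      by (intro wp_Cond wp_RAssign wp_Skip; simp only: b b' Suc)
        (simp_all add: S t envD(8)[OF env'' k] fin sg_def)
  qed (use env' V' vars p N k in simp_all)
next
  case (9 s')
  have "{t \<in> same V p. t < m} = same V p" by (auto simp: same_def)
  then show ?case using 9(1) by (simp add: weight_def)
qed (use envD[OF env] N in \<open>simp_all add: q_def\<close>)

lemma wp_pvec_prog:
  assumes env: "env s" and V: "repr V s" and p: "nats s ''p'' 0 = p" "p \<le> q" and N: "Suc q \<le> N"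
    and S: "reals s ''S'' 0 = weight V p"
  shows "wp N pvec_prog (\<lambda>s'. \<forall>i\<le>q. nats s' ''v'' i = nb (pvec V p i)) s"
  unfolding pvec_prog_def
proof (intro wp_Seq, rule wp_For[where K = "Suc q" and
    Inv = "\<lambda>k s. \<forall>i\<le>q. i < k \<longrightarrow> nats s ''v'' i = nb (V p i)"], goal_cases)
  case (8 k s')
  have env': "env s'" by (rule env_frame[OF _ 8(4)]) (simp_all add: env)
  have V': "repr V s'" by (rule repr_frame[OF _ 8(4)]) (simp_all add: V)
  have vars: "nats s' ''p'' 0 = p" "nats s' ''i'' 0 = k"
    using frame_nats[OF 8(4), of "''p''"] 8(3) p by simp_all
  have "k \<le> q" using 8(1) by simp
  then have W: "nats s' ''W'' (off p + k) = nb (V p k)" using reprD[OF V' p(2)] by simp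
  show ?case
    using 8(2) by (intro wp_NAssign) (simp add: vars envD(5)[OF env' p(2)] W less_Suc_eq)
next
  case (9 s')
  have env': "env s'" by (rule env_frame[OF _ 9(2)]) (simp_all add: env)
  have b: "bval (RLess (RCell ''S'' (NConst 0)) RZero) s' \<longleftrightarrow> weight V p < 0"
    using frame_reals[OF 9(2), of "''S''"] S by simp
  show ?case
    using 9(1) by (intro wp_Cond wp_NAssign; simp only: b) (auto simp: envD(3)[OF env'] pvec_def)
qed (use envD[OF env] N in simp_all)

text \<open>Updating in place is sound: the pivot row entry of a column is tested before the column
  changes, and the added vector is read from \<open>v\<close>, outside the matrix.\<close>

lemma wp_elim_prog:
  assumes env: "env s" and V: "repr V s" and l: "nats s ''l'' 0 = l" "l \<le> q" and N: "Suc q \<le> N"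
    and v: "\<forall>i\<le>q. nats s ''v'' i = nb (v i)"
  shows "wp N elim_prog (repr (\<lambda>j i. V j i + V j l * v i)) s"
  unfolding elim_prog_def
proof (rule wp_For[where K = "Suc q" and
    Inv = "\<lambda>k. repr (\<lambda>j i. if j < k then V j i + V j l * v i else V j i)"], goal_cases)
  case (8 k s')
  note k = 8(1) note Inv = 8(2)
  have env': "env s'" by (rule env_frame[OF _ 8(4)]) (simp_all add: env)
  have vars: "nats s' ''l'' 0 = l" "nats s' ''j'' 0 = k"
    using frame_nats[OF 8(4), of "''l''"] 8(3) l by simp_all
  have v': "\<forall>i\<le>q. nats s' ''v'' i = nb (v i)" using frame_nats[OF 8(4), of "''v''"] v by simp
  have kq: "k \<le> q" using k by simp
  have W: "nats s' ''W'' (off k + l) = nb (V k l)" using reprD[OF Inv kq l(2)] by simp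
  have b: "bval (pos_test (entry (cell ''j'') (cell ''l''))) s' \<longleftrightarrow> V k l = 1"
    by (simp add: vars envD(5)[OF env' kq] W)
  show ?case
  proof (intro wp_Cond wp_Skip; simp only: b)
    assume 1: "V k l = 1"
    show "wp N (For ''i'' ''N'' (set_entry (cell ''j'') (cell ''i'')
      (xor_exp (entry (cell ''j'') (cell ''i'')) (NCell ''v'' (cell ''i'')))))
      (repr (\<lambda>j i. if j < Suc k then V j i + V j l * v i else V j i)) s'"
    proof (rule wp_For[where K = "Suc q" and
        Inv = "\<lambda>h. repr (\<lambda>j i. if j < k \<or> j = k \<and> i < h then V j i + V j l * v i else V j i)"], goal_cases)
      case (8 h s'')
      have env'': "env s''" by (rule env_frame[OF env' 8(4)]) simp_all
      have vars': "nats s'' ''j'' 0 = k" "nats s'' ''i'' 0 = h" "nats s'' ''v'' h = nb (v h)"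
        using frame_nats[OF 8(4), of "''j''"] frame_nats[OF 8(4), of "''v''"] 8(1,3) vars v' by simp_all
      have hq: "h \<le> q" using 8(1) by simp
      have W': "nats s'' ''W'' (off k + h) = nb (V k h)" using reprD[OF 8(2) kq hq] by simp
      have a: "nval (NAdd (NCell ''o'' (cell ''j'')) (cell ''i'')) s'' = off k + h"
        by (simp add: vars' envD(5)[OF env'' kq])
      have x: "nval (xor_exp (entry (cell ''j'') (cell ''i'')) (NCell ''v'' (cell ''i''))) s'' = nb (V k h + v h)"
        by (simp add: vars' envD(5)[OF env'' kq] W' nb_xor)
      show ?case
      proof (intro wp_NAssign, unfold a x, rule repr_write[OF 8(2) kq hq])
        show "nb (V k h + v h) = nb (if k < k \<or> k = k \<and> h < Suc h then V k h + V k l * v h else V k h)"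
          using 1 by simp
      next
        fix j i assume "\<not> (j = k \<and> i = h)"
        then show "(if j < k \<or> j = k \<and> i < Suc h then V j i + V j l * v i else V j i) =
            (if j < k \<or> j = k \<and> i < h then V j i + V j l * v i else V j i)"
          by (auto simp: less_Suc_eq)
      qed
    next
      case (9 s'')
      show ?case by (rule repr_cong[OF 9(1)]) (auto simp: less_Suc_eq)
    qed (use envD[OF env'] N Inv in simp_all)
  next
    assume "V k l \<noteq> 1"
    then show "repr (\<lambda>j i. if j < Suc k then V j i + V j l * v i else V j i) s'"
      by (intro repr_cong[OF Inv]) (auto simp: less_Suc_eq)
  qed
next
  case (9 s')
  show ?case by (rule repr_cong[OF 9(1)]) simp
qed (use envD[OF env] N V in simp_all)

lemma wp_step_prog:
  assumes env: "env s" and V: "repr V s" and p: "nats s ''p'' 0 = p" "p \<le> q" and N: "Suc q \<le> N"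
  shows "wp N step_prog (repr (step p V)) s"
  unfolding step_prog_def
proof (rule wp_Seq, rule wp_conseq[OF wp_pivot_prog[OF assms]])
  fix s1 assume f1: "frame pivot_prog s s1"
    and l: "nats s1 ''l'' 0 = (if null V p then q else pivot V p)"
  have env1: "env s1" by (rule env_frame[OF env f1]) simp_all
  have V1: "repr V s1" by (rule repr_frame[OF V f1]) simp
  have p1: "nats s1 ''p'' 0 = p" using frame_nats[OF f1, of "''p''"] p by simp
  have b: "bval (NLess (cell ''l'') (cell ''q'')) s1 \<longleftrightarrow> \<not> null V p"
    using l pivot(1)[of V p] n_le_q by (auto simp: envD(3)[OF env1])
  show "wp N (Cond (NLess (cell ''l'') (cell ''q'')) (Seq weight_prog (Seq pvec_prog elim_prog)) Skip)
      (repr (step p V)) s1"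
  proof (intro wp_Cond wp_Skip; (simp only: b not_not)?)
    assume nn: "\<not> null V p"
    show "wp N (Seq weight_prog (Seq pvec_prog elim_prog)) (repr (step p V)) s1"
    proof (rule wp_Seq, rule wp_conseq[OF wp_weight_prog[OF env1 V1 p1 p(2) N]])
      fix s2 assume f2: "frame weight_prog s1 s2" and S: "reals s2 ''S'' 0 = weight V p"
      have env2: "env s2" by (rule env_frame[OF env1 f2]) simp_all
      have V2: "repr V s2" by (rule repr_frame[OF V1 f2]) simp
      have p2: "nats s2 ''p'' 0 = p" using frame_nats[OF f2, of "''p''"] p1 by simp
      show "wp N (Seq pvec_prog elim_prog) (repr (step p V)) s2"
      proof (rule wp_Seq, rule wp_conseq[OF wp_pvec_prog[OF env2 V2 p2 p(2) N S]])
        fix s3 assume f3: "frame pvec_prog s2 s3" and v: "\<forall>i\<le>q. nats s3 ''v'' i = nb (pvec V p i)"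
        have env3: "env s3" by (rule env_frame[OF env2 f3]) simp_all
        have V3: "repr V s3" by (rule repr_frame[OF V2 f3]) simp
        have l3: "nats s3 ''l'' 0 = pivot V p"
          using frame_nats[OF f2, of "''l''"] frame_nats[OF f3, of "''l''"] l nn by simp
        have "pivot V p \<le> q" using pivot(1)[OF nn] n_le_q by simp
        then show "wp N elim_prog (repr (step p V)) s3"
          using wp_elim_prog[OF env3 V3 l3 _ N v] nn by (simp add: step_def)
      qed
    qed
  next
    assume "null V p"
    then show "repr (step p V) s1" using V1 by (simp add: step_def)
  qed
qed

section \<open>Correctness of the full elimination, the search for relations and the
  shrinking\<close>

definition flags :: "(nat \<Rightarrow> bool) \<Rightarrow> state \<Rightarrow> bool" where
  "flags K s \<longleftrightarrow> (\<forall>p<q. nats s ''K'' p = of_bool (K p))"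

definition chosen :: "nat set \<Rightarrow> state \<Rightarrow> bool" where
  "chosen X s \<longleftrightarrow> (\<forall>p<n. nats s ''K'' p = 0) \<and> (\<forall>t<m. nats s ''K'' (n + t) = of_bool (t \<in> X))"

lemma chosen_flags:
  assumes "chosen X s"
  shows "flags (term_flags X) s"
  unfolding flags_def
proof (intro allI impI)
  fix p assume p: "p < q"
  show "nats s ''K'' p = of_bool (term_flags X p)"
  proof (cases "p < n")
    case False
    then obtain t where t: "p = n + t" by (metis le_Suc_ex not_less)
    then show ?thesis using assms p by (simp add: chosen_def term_flags_def q_def)
  qed (use assms in \<open>simp add: chosen_def term_flags_def\<close>)
qed

lemma wp_run_prog:
  assumes env: "env s" and V: "repr V s" and K: "flags K s" and N: "Suc q \<le> N"
  shows "wp N run_prog (repr (run K q V)) s"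
  unfolding run_prog_def
proof (rule wp_For[where K = q and Inv = "\<lambda>k. repr (run K k V)"], goal_cases)
  case (8 k s')
  have env': "env s'" by (rule env_frame[OF env 8(4)]) simp_all
  have "nats s' ''K'' = nats s ''K''" using frame_nats[OF 8(4), of "''K''"] by simp
  then have b: "bval (pos_test (NCell ''K'' (cell ''p''))) s' \<longleftrightarrow> K k"
    using K 8(1,3) by (simp add: flags_def)
  show ?case
  proof (intro wp_Cond wp_Skip; simp only: b)
    assume "K k"
    then show "wp N step_prog (repr (run K (Suc k) V)) s'"
      using wp_step_prog[OF env' 8(2,3) _ N] 8(1) by simp
  next
    assume "\<not> K k"
    then show "repr (run K (Suc k) V) s'" using 8(2) by simp
  qed
qed (use envD[OF env] N V in simp_all)

lemma wp_null_test:
  assumes env: "env s" and V: "repr V s" and N: "Suc q \<le> N"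
    and t: "nats s ''t'' 0 = t" "t < m" and e: "nats s ''e'' 0 = 0"
  shows "wp N (For ''i'' ''n'' (Cond (pos_test (entry term_col (cell ''i''))) (set_var ''e'' (NConst 1)) Skip))
    (\<lambda>s'. nats s' ''e'' 0 = of_bool (\<not> null V (n + t))) s"
proof (rule wp_For[where K = n and
    Inv = "\<lambda>k s. nats s ''e'' 0 = of_bool (\<exists>i<k. V (n + t) i = 1)"], goal_cases)
  case (8 k s')
  have env': "env s'" by (rule env_frame[OF env 8(4)]) simp_all
  have V': "repr V s'" by (rule repr_frame[OF V 8(4)]) simp
  have vars: "nats s' ''i'' 0 = k" "nats s' ''t'' 0 = t"
    using frame_nats[OF 8(4), of "''t''"] 8(3) t by simp_all
  have le: "k \<le> q" "n + t \<le> q" using 8(1) t(2) by (simp_all add: q_def)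
  have b: "bval (pos_test (entry term_col (cell ''i''))) s' \<longleftrightarrow> V (n + t) k = 1"
    using reprD[OF V' le(2,1)] by (simp add: vars envD(1,5)[OF env'] le)
  show ?case
    using 8(2) by (intro wp_Cond wp_NAssign wp_Skip; simp only: b) (auto simp: less_Suc_eq)
next
  case (9 s')
  then show ?case by (simp add: null_def)
qed (use envD[OF env] N n_le_q e in simp_all)

lemma wp_search_prog:
  assumes env: "env s" and V: "repr V s" and N: "Suc q \<le> N"
  shows "wp N search_prog (\<lambda>s'. (\<exists>t<m. nats s' ''w'' 0 = n + t \<and> null V (n + t) \<and> V (n + t) (n + t) = 1) \<or>
    nats s' ''w'' 0 = q \<and> stable V) s"
  unfolding search_prog_def
proof (intro wp_Seq wp_NAssign, rule wp_For[where K = m and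
    Inv = "\<lambda>k s. (\<exists>t<m. nats s ''w'' 0 = n + t \<and> null V (n + t) \<and> V (n + t) (n + t) = 1) \<or>
    nats s ''w'' 0 = q \<and> (\<forall>t<k. null V (n + t) \<longrightarrow> V (n + t) (n + t) = 0)"], goal_cases)
  case (8 k s')
  note k = 8(1) note Inv = 8(2)
  have env': "env s'" by (rule env_frame[OF _ 8(4)]) (simp_all add: env)
  have V': "repr V s'" by (rule repr_frame[OF _ 8(4)]) (simp_all add: V)
  have nk: "n + k \<le> q" using k by (simp add: q_def)
  show ?case
  proof (intro wp_Seq wp_NAssign, rule wp_conseq, rule wp_null_test[of _ V N k], goal_cases)
    case (7 s'')
    have env'': "env s''" by (rule env_frame[OF _ 7(1)]) (simp_all add: env')
    have V'': "repr V s''" by (rule repr_frame[OF _ 7(1)]) (simp_all add: V')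
    have vars: "nats s'' ''t'' 0 = k" "nats s'' ''w'' = nats s' ''w''"
      using frame_nats[OF 7(1), of "''t''"] frame_nats[OF 7(1), of "''w''"] 8(3) by simp_all
    have b: "bval (BAnd (BNot (pos_test (cell ''e''))) (pos_test (entry term_col term_col))) s'' \<longleftrightarrow>
        null V (n + k) \<and> V (n + k) (n + k) = 1"
      using reprD[OF V'' nk nk] 7(2) by (simp add: vars envD(1,5)[OF env''] nk)
    show ?case
    proof (intro wp_Cond wp_NAssign wp_Skip; simp only: b)
      assume "null V (n + k) \<and> V (n + k) (n + k) = 1"
      then show "(\<exists>t<m. nats (write_nat ''w'' (nval (NConst 0) s'') (nval term_col s'') s'') ''w'' 0 = n + t \<and>
          null V (n + t) \<and> V (n + t) (n + t) = 1) \<or>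
          nats (write_nat ''w'' (nval (NConst 0) s'') (nval term_col s'') s'') ''w'' 0 = q \<and>
          (\<forall>t<Suc k. null V (n + t) \<longrightarrow> V (n + t) (n + t) = 0)"
        using k by (intro disjI1 exI[of _ k]) (simp add: vars envD(1)[OF env''])
    next
      assume "\<not> (null V (n + k) \<and> V (n + k) (n + k) = 1)"
      then show "(\<exists>t<m. nats s'' ''w'' 0 = n + t \<and> null V (n + t) \<and> V (n + t) (n + t) = 1) \<or>
          nats s'' ''w'' 0 = q \<and> (\<forall>t<Suc k. null V (n + t) \<longrightarrow> V (n + t) (n + t) = 0)"
        using Inv by (auto simp: vars(2) less_Suc_eq)
    qed
  qed (use env' V' N k 8(3) in simp_all)
next
  case (9 s')
  then show ?case by (simp add: stable_def)
qed (use envD[OF env] N in \<open>simp_all add: q_def\<close>)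

lemma wp_copy_prog:
  assumes env: "env s" and V: "repr V s" and N: "Suc q \<le> N" and X: "chosen X s"
  shows "wp N copy_prog (chosen (tags V q)) s"
  unfolding copy_prog_def
proof (rule wp_For[where K = m and Inv = "\<lambda>k s. (\<forall>p<n. nats s ''K'' p = 0) \<and>
    (\<forall>t<k. nats s ''K'' (n + t) = of_bool (t \<in> tags V q))"], goal_cases)
  case (8 k s')
  have env': "env s'" by (rule env_frame[OF env 8(4)]) simp_all
  have V': "repr V s'" by (rule repr_frame[OF V 8(4)]) simp
  have nk: "n + k \<le> q" using 8(1) by (simp add: q_def)
  have a: "nval term_col s' = n + k" by (simp add: 8(3) envD(1)[OF env'])
  have x: "nval (entry (cell ''q'') term_col) s' = of_bool (k \<in> tags V q)"
    using reprD[OF V' _ nk, of q] a 8(1) by (simp add: envD(3,5)[OF env'] tags_def nb_def)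
  show ?case
    by (intro wp_NAssign, unfold a x) (use 8(2) in \<open>auto simp: less_Suc_eq\<close>)
next
  case (9 s')
  then show ?case by (simp add: chosen_def)
qed (use envD[OF env] N X in \<open>simp_all add: q_def chosen_def\<close>)

lemma wp_update_prog:
  assumes env: "env s" and V: "repr V s" and N: "Suc q \<le> N" and X: "chosen X s"
    and w: "nats s ''w'' 0 = w" "w \<le> q"
  shows "wp N update_prog (chosen (sym_diff X (tags V w))) s"
  unfolding update_prog_def
proof (rule wp_For[where K = m and Inv = "\<lambda>k s. (\<forall>p<n. nats s ''K'' p = 0) \<and>
    (\<forall>t<m. nats s ''K'' (n + t) = of_bool (if t < k then t \<in> sym_diff X (tags V w) else t \<in> X))"], goal_cases)
  case (8 k s')
  have env': "env s'" by (rule env_frame[OF env 8(4)]) simp_all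
  have V': "repr V s'" by (rule repr_frame[OF V 8(4)]) simp
  have w': "nats s' ''w'' 0 = w" using frame_nats[OF 8(4), of "''w''"] w by simp
  have nk: "n + k \<le> q" using 8(1) by (simp add: q_def)
  have a: "nval term_col s' = n + k" by (simp add: 8(3) envD(1)[OF env'])
  have W: "nval (entry (cell ''w'') term_col) s' = of_bool (k \<in> tags V w)"
    using reprD[OF V' w(2) nk] a 8(1) by (simp add: w' w(2) envD(5)[OF env'] tags_def nb_def)
  have K: "nval (NCell ''K'' term_col) s' = of_bool (k \<in> X)"
    using 8(1,2) a by simp
  have x: "nval (xor_exp (NCell ''K'' term_col) (entry (cell ''w'') term_col)) s' = of_bool (k \<in> sym_diff X (tags V w))"
    unfolding nval.simps(3,4) W K by auto
  show ?case
    by (intro wp_NAssign, unfold a x) (use 8(2) in \<open>auto simp: less_Suc_eq\<close>)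
next
  case (9 s')
  then show ?case by (simp add: chosen_def)
qed (use envD[OF env] N X in \<open>simp_all add: q_def chosen_def\<close>)

lemma wp_init_run_prog:
  assumes env: "env s" and N: "Suc q \<le> N" and K: "flags K s"
    and Q: "\<And>s'. env s' \<Longrightarrow> repr (run K q V0) s' \<Longrightarrow>
      (\<And>u. u \<notin> nat_writes init_prog \<union> nat_writes run_prog \<Longrightarrow> nats s' u = nats s u) \<Longrightarrow> wp N p Q s'"
  shows "wp N (Seq init_prog (Seq run_prog p)) Q s"
proof (rule wp_Seq, rule wp_conseq[OF wp_init_prog[OF env N]])
  fix s1 assume f1: "frame init_prog s s1" and V1: "repr V0 s1"
  have env1: "env s1" by (rule env_frame[OF env f1]) simp_all
  have K1: "flags K s1" using K frame_nats[OF f1, of "''K''"] by (simp add: flags_def)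
  show "wp N (Seq run_prog p) Q s1"
  proof (rule wp_Seq, rule wp_conseq[OF wp_run_prog[OF env1 V1 K1 N]])
    fix s2 assume f2: "frame run_prog s1 s2" and V2: "repr (run K q V0) s2"
    have env2: "env s2" by (rule env_frame[OF env1 f2]) simp_all
    show "wp N p Q s2"
      by (rule Q[OF env2 V2]) (use frame_nats[OF f1] frame_nats[OF f2] in simp)
  qed
qed

text \<open>As long as the set is not stable, each round lowers its cardinality, which starts at
  most at \<open>m\<close>. After \<open>q + 1\<close> rounds, more than \<open>m\<close>, the
  cardinality disjunct of the invariant is impossible.\<close>

lemma wp_shrink_prog:
  assumes env: "env s" and N: "Suc q \<le> N" and X: "chosen X s" "good \<rho> X"
    and nz: "\<And>t. t < m \<Longrightarrow> \<exists>i<n. I t i = 1"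
    and dist: "\<And>s t. s < m \<Longrightarrow> t < m \<Longrightarrow> s \<noteq> t \<Longrightarrow> \<exists>i<n. I s i \<noteq> I t i"
  shows "wp N shrink_prog (\<lambda>s'. \<exists>X. chosen X s' \<and> good \<rho> X \<and> stable (run (term_flags X) q V0)) s"
  unfolding shrink_prog_def
proof (rule wp_For[where K = "Suc q" and Inv = "\<lambda>k s. \<exists>X. chosen X s \<and> good \<rho> X \<and>
    (card X + k \<le> m \<or> stable (run (term_flags X) q V0))"], goal_cases)
  case 6
  have "X \<subseteq> {..<m}" using X(2) by (simp add: good_def)
  then have "card X \<le> m" using card_mono[of "{..<m}" X] by simp
  then show ?case using X by auto
next
  case (8 k s')
  have env': "env s'" by (rule env_frame[OF env 8(4)]) simp_all
  obtain X where X: "chosen X s'" "good \<rho> X" "card X + k \<le> m \<or> stable (run (term_flags X) q V0)"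
    using 8(2) by blast
  let ?V = "run (term_flags X) q V0"
  show ?case
  proof (rule wp_init_run_prog[OF env' N chosen_flags[OF X(1)]], rule wp_Seq, rule wp_conseq[OF wp_search_prog[OF _ _ N]])
    fix s1 s2
    assume env1: "env s1" and V1: "repr ?V s1"
      and n1: "\<And>u. u \<notin> nat_writes init_prog \<union> nat_writes run_prog \<Longrightarrow> nats s1 u = nats s' u"
      and f2: "frame search_prog s1 s2"
      and w: "(\<exists>t<m. nats s2 ''w'' 0 = n + t \<and> null ?V (n + t) \<and> ?V (n + t) (n + t) = 1) \<or>
        nats s2 ''w'' 0 = q \<and> stable ?V"
    have env2: "env s2" by (rule env_frame[OF env1 f2]) simp_all
    have V2: "repr ?V s2" by (rule repr_frame[OF V1 f2]) simp
    have X2: "chosen X s2"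
      using X(1) n1[of "''K''"] frame_nats[OF f2, of "''K''"] by (simp add: chosen_def)
    have b: "bval (NLess (cell ''w'') (cell ''q'')) s2 \<longleftrightarrow> nats s2 ''w'' 0 < q"
      using envD(3)[OF env2] by simp
    show "wp N (Cond (NLess (cell ''w'') (cell ''q'')) update_prog Skip) (\<lambda>s. \<exists>X. chosen X s \<and> good \<rho> X \<and>
      (card X + Suc k \<le> m \<or> stable (run (term_flags X) q V0))) s2"
    proof (intro wp_Cond wp_Skip; simp only: b)
      assume "nats s2 ''w'' 0 < q"
      then obtain t where t: "t < m" "nats s2 ''w'' 0 = n + t" "null ?V (n + t)" "?V (n + t) (n + t) = 1"
        using w by auto
      note sh = good_shrink[OF X(2) t(1) refl t(3,4) nz dist]
      have "\<not> stable ?V" using t by (auto simp: stable_def)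
      then have "card (sym_diff X (tags ?V (n + t))) + Suc k \<le> m" using sh(2) X(3) by simp
      then show "wp N update_prog (\<lambda>s. \<exists>X. chosen X s \<and> good \<rho> X \<and>
          (card X + Suc k \<le> m \<or> stable (run (term_flags X) q V0))) s2"
        using sh(1) t(1) by (intro wp_conseq[OF wp_update_prog[OF env2 V2 N X2 t(2)]]) (auto simp: q_def)
    next
      assume "\<not> nats s2 ''w'' 0 < q"
      then have "stable ?V" using w by (auto simp: q_def)
      then show "\<exists>X. chosen X s2 \<and> good \<rho> X \<and> (card X + Suc k \<le> m \<or> stable (run (term_flags X) q V0))"
        using X2 X(2) by blast
    qed
  qed
next
  case (9 s')
  then show ?case by (auto simp: q_def)
qed (use envD[OF env] N in \<open>simp_all add: chosen_def\<close>)

section \<open>Correctness of setup, output and the whole program\<close>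

definition input :: "state \<Rightarrow> bool" where
  "input s \<longleftrightarrow> nats s ''n'' 0 = n \<and> nats s ''m'' 0 = m \<and> nats s ''c'' 0 = 0 \<and> nats s ''d'' 0 = 0 \<and>
    (\<forall>p. nats s ''K'' p = 0) \<and> (\<forall>t<m. \<forall>i<n. nats s ''A'' (t * n + i) = nb (I t i)) \<and>
    (\<forall>t<m. reals s ''coeff'' t = c t)"

text \<open>The initial zeros matter: \<open>c\<close> and \<open>d\<close> accumulate offsets from
  0, and the flags of the variable columns are left as found.\<close>

lemma wp_setup_prog:
  assumes s: "input s" and N: "Suc q \<le> N"
  shows "wp N setup_prog (\<lambda>s'. env s' \<and> chosen {..<m} s') s"
  unfolding setup_prog_def
proof (intro wp_Seq wp_NAssign, rule wp_For[where K = "Suc q" and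
    Inv = "\<lambda>k s. nats s ''c'' 0 = off k \<and> (\<forall>j<k. nats s ''o'' j = off j)"], goal_cases)
  case (8 k s')
  have "nats s' ''N'' 0 = Suc q"
    using frame_nats[OF 8(4), of "''N''"] s by (simp add: input_def q_def)
  then show ?case
    using 8(2,3) by (intro wp_Seq wp_NAssign) (auto simp: less_Suc_eq off_def)
next
  case (9 s1)
  note o1 = 9(1)
  have v1: "nats s1 ''n'' 0 = n" "nats s1 ''m'' 0 = m" "nats s1 ''q'' 0 = q" "nats s1 ''N'' 0 = Suc q"
    "nats s1 ''d'' 0 = 0" "nats s1 ''K'' = nats s ''K''" "nats s1 ''A'' = nats s ''A''"
    "reals s1 ''coeff'' = reals s ''coeff''"
    using s frame_nats[OF 9(2)] frame_reals[OF 9(2)] by (simp_all add: input_def q_def)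
  show ?case
  proof (rule wp_Seq, rule wp_For[where K = m and
      Inv = "\<lambda>k s. nats s ''d'' 0 = k * n \<and> (\<forall>j<k. nats s ''a'' j = j * n)"], goal_cases)
    case (8 k s')
    have "nats s' ''n'' 0 = n"
      using frame_nats[OF 8(4), of "''n''"] v1(1) by simp
    then show ?case
      using 8(2,3) by (intro wp_Seq wp_NAssign) (auto simp: less_Suc_eq)
  next
    case (9 s2)
    have v2: "nats s2 ''n'' 0 = n" "nats s2 ''m'' 0 = m" "nats s2 ''q'' 0 = q" "nats s2 ''N'' 0 = Suc q"
      "nats s2 ''o'' = nats s1 ''o''" "nats s2 ''K'' = nats s ''K''" "nats s2 ''A'' = nats s ''A''"
      "reals s2 ''coeff'' = reals s ''coeff''"
      using v1 frame_nats[OF 9(2)] frame_reals[OF 9(2)] by simp_all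
    have env2: "env s2"
      unfolding env_def using v2 o1 9(1) s by (simp add: input_def less_Suc_eq_le)
    show ?case
    proof (rule wp_For[where K = m and Inv = "\<lambda>k s. (\<forall>p<n. nats s ''K'' p = 0) \<and>
        (\<forall>t<k. nats s ''K'' (n + t) = 1)"], goal_cases)
      case (8 k s')
      have "nats s' ''n'' 0 = n"
        using frame_nats[OF 8(4), of "''n''"] v2(1) by simp
      then show ?case
        using 8(2,3) by (intro wp_NAssign) (auto simp: less_Suc_eq)
    next
      case (9 s3)
      have "env s3" by (rule env_frame[OF env2 9(2)]) simp_all
      then show ?case using 9(1) by (simp add: chosen_def)
    qed (use v2 N s in \<open>simp_all add: q_def input_def\<close>)
  qed (use v1 N in \<open>simp_all add: q_def\<close>)
qed (use s N in \<open>simp_all add: input_def q_def off_def\<close>)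

lemma wp_output:
  assumes env: "env s" and V: "repr V s" and N: "Suc q \<le> N"
  shows "wp N (For ''i'' ''n'' (NAssign ''x'' (cell ''i'') (entry (cell ''i'') (cell ''q''))))
    (\<lambda>s'. \<forall>i<n. nats s' ''x'' i = nb (V i q)) s"
proof (rule wp_For[where K = n and Inv = "\<lambda>k s. \<forall>i<k. nats s ''x'' i = nb (V i q)"], goal_cases)
  case (8 k s')
  have env': "env s'" by (rule env_frame[OF env 8(4)]) simp_all
  have V': "repr V s'" by (rule repr_frame[OF V 8(4)]) simp
  have k: "k \<le> q" using 8(1) by (simp add: q_def)
  then have "nval (entry (cell ''i'') (cell ''q'')) s' = nb (V k q)"
    using reprD[OF V' k, of q] by (simp add: 8(3) envD(3,5)[OF env'])
  then show ?case
    using 8(2,3) by (intro wp_NAssign) (simp add: less_Suc_eq)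
qed (use envD[OF env] N n_le_q in simp_all)

text \<open>The postcondition keeps just what \<open>good_card\<close> and
  \<open>final_value\<close> consume: the shrunken set and the sign bits of the variables.\<close>

lemma wp_algorithm:
  assumes s: "input s" and N: "Suc q \<le> N"
    and rank: "\<And>B. B \<subseteq> {..<m} \<Longrightarrow> (\<forall>t<m. \<exists>T\<subseteq>B. \<forall>i<n. I t i = (\<Sum>s\<in>T. I s i)) \<Longrightarrow> \<rho> \<le> card B"
    and nz: "\<And>t. t < m \<Longrightarrow> \<exists>i<n. I t i = 1"
    and dist: "\<And>s t. s < m \<Longrightarrow> t < m \<Longrightarrow> s \<noteq> t \<Longrightarrow> \<exists>i<n. I s i \<noteq> I t i"
  shows "wp N algorithm (\<lambda>s'. \<exists>X V. good \<rho> X \<and> stable (run (term_flags X) q V0) \<and>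
    V = run (\<lambda>_. True) q (run (term_flags X) q V0) \<and> (\<forall>i<n. nats s' ''x'' i = nb (V i q))) s"
    (is "wp _ _ ?post _")
  unfolding algorithm_def
proof (rule wp_Seq, rule wp_conseq[OF wp_setup_prog[OF s N]], elim conjE, rule wp_init_run_prog[OF _ N chosen_flags],
    assumption, assumption)
  fix s0 s1
  assume X0: "chosen {..<m} s0" and env1: "env s1"
    and V1: "repr (run (term_flags {..<m}) q V0) s1"
    and n1: "\<And>u. u \<notin> nat_writes init_prog \<union> nat_writes run_prog \<Longrightarrow> nats s1 u = nats s0 u"
  have X1: "chosen {..<m} s1" using X0 n1[of "''K''"] by (simp add: chosen_def)
  let ?X = "tags (run (term_flags {..<m}) q V0) q"
  let ?out = "For ''i'' ''n'' (NAssign ''x'' (cell ''i'') (entry (cell ''i'') (cell ''q'')))"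
  let ?all = "For ''j'' ''q'' (NAssign ''K'' (cell ''j'') (NConst 1))"
  show "wp N (Seq copy_prog (Seq shrink_prog (Seq init_prog (Seq run_prog (Seq ?all (Seq run_prog ?out)))))) ?post s1"
  proof (rule wp_Seq, rule wp_conseq[OF wp_copy_prog[OF env1 V1 N X1]])
    fix s2 assume f2: "frame copy_prog s1 s2" and X2: "chosen ?X s2"
    have env2: "env s2" by (rule env_frame[OF env1 f2]) simp_all
    show "wp N (Seq shrink_prog (Seq init_prog (Seq run_prog (Seq ?all (Seq run_prog ?out))))) ?post s2"
    proof (rule wp_Seq, rule wp_conseq[OF wp_shrink_prog[OF env2 N X2 good_initial[OF rank] nz dist]];
        (assumption | elim exE conjE)?)
      fix s3 X
      assume f3: "frame shrink_prog s2 s3" and X3: "chosen X s3"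
        and X: "good \<rho> X" "stable (run (term_flags X) q V0)"
      have env3: "env s3" by (rule env_frame[OF env2 f3]) simp_all
      let ?V = "run (term_flags X) q V0"
      show "wp N (Seq init_prog (Seq run_prog (Seq ?all (Seq run_prog ?out)))) ?post s3"
      proof (rule wp_init_run_prog[OF env3 N chosen_flags[OF X3]])
        fix s4 assume env4: "env s4" and V4: "repr ?V s4"
        show "wp N (Seq ?all (Seq run_prog ?out)) ?post s4"
        proof (rule wp_Seq, rule wp_For[where K = q and Inv = "\<lambda>k s. \<forall>p<k. nats s ''K'' p = 1"], goal_cases)
          case (8 k s')
          then show ?case by (intro wp_NAssign) (simp add: less_Suc_eq)
        next
          case (9 s5)
          have env5: "env s5" by (rule env_frame[OF env4 9(2)]) simp_all
          have V5: "repr ?V s5" by (rule repr_frame[OF V4 9(2)]) simp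
          have K5: "flags (\<lambda>_. True) s5" using 9(1) by (simp add: flags_def)
          show ?case
          proof (rule wp_Seq, rule wp_conseq[OF wp_run_prog[OF env5 V5 K5 N]])
            fix s6 assume f6: "frame run_prog s5 s6" and V6: "repr (run (\<lambda>_. True) q ?V) s6"
            have env6: "env s6" by (rule env_frame[OF env5 f6]) simp_all
            show "wp N ?out ?post s6"
              by (rule wp_conseq[OF wp_output[OF env6 V6 N]]) (use X in blast)
          qed
        qed (use envD[OF env4] N in simp_all)
      qed
    qed
  qed
qed

end

section \<open>The bound\<close>

lemma output_point_cube: "output_point n s \<in> cube n"
  by (auto simp: output_point_def cube_def)

lemma input_state_input:
  "term_system.input n (length Is) (\<lambda>t i. of_bool (i \<in> Is ! t)) (\<lambda>t. a (Is ! t)) (input_state n a Is)"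
proof -
  have "t * n + i < length Is * n" "(t * n + i) mod n = i" "(t * n + i) div n = t"
    if "t < length Is" "i < n" for t i
  proof -
    have "t * n + i < Suc t * n" using that by simp
    also have "\<dots> \<le> length Is * n" using that by (intro mult_le_mono1) simp
    finally show "t * n + i < length Is * n" .
  qed (use that in auto)
  then show ?thesis unfolding term_system.input_def by (auto simp: input_state_def nb_def)
qed

theorem theorem6:
  shows "\<exists>(alg :: com) (C :: nat) (d :: nat).
    \<forall>(n :: nat) (r :: nat) (f :: (nat \<Rightarrow> real) \<Rightarrow> real) (a :: nat set \<Rightarrow> real)
      (F :: nat set set) (Is :: nat set list).
      fourier_expansion n f a F \<and> r = fourier_degree F \<and> r \<ge> 1 \<and> distinct Is \<and> set Is = F \<longrightarrow>
        (let B = a {} + real ((rank_F2 n Is + r - 1) div r) * Min ((\<lambda>I. \<bar>a I\<bar>) ` F) in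
          Max (f ` cube n) \<ge> B \<and>
          (\<exists>t s. exec alg (input_state n a Is) t s \<and>
             t \<le> C * (n * card F) ^ d \<and>
             output_point n s \<in> cube n \<and> f (output_point n s) \<ge> B))"
proof -
  obtain C d where cost: "\<forall>N\<ge>1. cost N algorithm \<le> C * N ^ d" using cost_poly by blast
  show ?thesis
  proof (rule exI[of _ algorithm], rule exI[of _ "C * 3 ^ d"], rule exI[of _ d], intro allI impI, elim conjE)
    fix n r :: nat and f :: "(nat \<Rightarrow> real) \<Rightarrow> real" and a :: "nat set \<Rightarrow> real" and F Is
    assume f: "fourier_expansion n f a F" and r: "r = fourier_degree F" "r \<ge> 1"
      and Is: "distinct Is" "set Is = F"
    define m where "m = length Is"
    define I :: "nat \<Rightarrow> nat \<Rightarrow> bit" where "I = (\<lambda>t i. of_bool (i \<in> Is ! t))"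
    define c where "c = (\<lambda>t. a (Is ! t))"
    interpret term_system n m I c .
    define M where "M = Min ((\<lambda>I. \<bar>a I\<bar>) ` F)"
    define \<rho> where "\<rho> = rank_F2 n Is"
    have F: "finite F" "\<And>J. J \<in> F \<Longrightarrow> J \<noteq> {} \<and> J \<subseteq> {..<n}"
      using Is f by (auto simp: fourier_expansion_def)
    have "F \<noteq> {}" using r by (auto simp: fourier_degree_def)
    have nth: "Is ! t \<in> F" if "t < m" for t using that Is by (auto simp: m_def)
    have bij: "bij_betw ((!) Is) {..<m} F"
      using Is by (intro bij_betw_nth) (simp_all add: m_def)
    have mF: "m = card F" using Is by (simp add: m_def distinct_card[symmetric])
    have "m \<ge> 1" using \<open>F \<noteq> {}\<close> F(1) mF by (simp add: Suc_le_eq card_gt_0_iff)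
    have "n \<ge> 1" using F(2) \<open>F \<noteq> {}\<close> by (cases n) auto
    have nz: "\<exists>i<n. I t i = 1" if "t < m" for t
    proof -
      have "Is ! t \<noteq> {}" "Is ! t \<subseteq> {..<n}" using F(2)[OF nth[OF that]] by auto
      then show ?thesis by (auto simp: I_def)
    qed
    \<comment> \<open>Terms are subsets of \<open>{..<n}\<close> and the list has no repetitions, so
      two columns differ in some row.\<close>
    have dist: "\<exists>i<n. I s i \<noteq> I t i" if "s < m" "t < m" "s \<noteq> t" for s t
    proof (rule ccontr)
      assume "\<not> ?thesis"
      then have "\<forall>i<n. i \<in> Is ! s \<longleftrightarrow> i \<in> Is ! t" by (simp add: I_def of_bool_eq_iff)
      then have "Is ! s = Is ! t" using F(2)[OF nth[OF that(1)]] F(2)[OF nth[OF that(2)]] by blast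
      then show False using that Is(1) by (simp add: m_def nth_eq_iff_index_eq)
    qed
    have rank: "\<rho> \<le> card B"
      if "B \<subseteq> {..<m}" "\<forall>t<m. \<exists>T\<subseteq>B. \<forall>i<n. I t i = (\<Sum>s\<in>T. I s i)" for B
      using that unfolding \<rho>_def m_def I_def by (rule rank_F2_le_card)
    have "input (input_state n a Is)"
      using input_state_input unfolding m_def I_def c_def .
    from wp_algorithm[OF this order_refl rank nz dist]
    obtain t s X V where ex: "exec algorithm (input_state n a Is) t s" "t \<le> cost (Suc q) algorithm"
      and X: "good \<rho> X" "stable (run (term_flags X) q V0)"
      and V: "V = run (\<lambda>_. True) q (run (term_flags X) q V0)"
      and out: "\<forall>i<n. nats s ''x'' i = nb (V i q)"
      unfolding wp_def by blast
    have Xm: "X \<subseteq> {..<m}" using X(1) by (simp add: good_def)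
    let ?x = "output_point n s"
    have x: "?x i = sg (V i q)" if "i < n" for i
      using out that by (simp add: output_point_def sg_def nb_def)
    have prod: "(\<Prod>i\<in>Is ! t. ?x i) = sg (\<Sum>k<n. I t k * V k q)" if "t < m" for t
    proof -
      have sub: "Is ! t \<subseteq> {..<n}" using F(2)[OF nth[OF that]] by auto
      then have "(\<Prod>i\<in>Is ! t. ?x i) = (\<Prod>i\<in>Is ! t. sg (V i q))" by (intro prod.cong) (auto simp: x)
      also have "\<dots> = sg (\<Sum>i\<in>Is ! t. V i q)" using sub finite_subset by (intro prod_sg) blast
      also have "{k \<in> {..<n}. I t k = 1} = Is ! t" using sub by (auto simp: I_def)
      then have "(\<Sum>i\<in>Is ! t. V i q) = (\<Sum>k<n. I t k * V k q)"
        using sum_bit_mult[of "{..<n}" "I t" "\<lambda>k. V k q"] by simp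
      finally show ?thesis .
    qed
    have "f ?x = a {} + (\<Sum>J\<in>F. a J * (\<Prod>i\<in>J. ?x i))"
      using f output_point_cube by (simp add: fourier_expansion_def)
    also have "(\<Sum>J\<in>F. a J * (\<Prod>i\<in>J. ?x i)) = (\<Sum>t<m. c t * sg (\<Sum>k<n. I t k * V k q))"
      by (subst sum.reindex_bij_betw[OF bij, symmetric]) (simp add: prod c_def)
    finally have fx: "f ?x \<ge> a {} + (\<Sum>t\<in>X. \<bar>c t\<bar>)"
      using final_value[OF Xm X(2) nz V] by simp
    have M_le: "M \<le> \<bar>c t\<bar>" if "t < m" for t
      unfolding M_def c_def using F(1) nth[OF that] by (intro Min_le) auto
    have "M \<in> (\<lambda>I. \<bar>a I\<bar>) ` F" unfolding M_def using F(1) \<open>F \<noteq> {}\<close> by (intro Min_in) auto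
    then have "M \<ge> 0" by auto
    have "card {i. i < n \<and> I t i = 1} \<le> r" if "t < m" for t
    proof -
      have "{i. i < n \<and> I t i = 1} = Is ! t" using F(2)[OF nth[OF that]] by (auto simp: I_def)
      then show ?thesis
        unfolding r(1) fourier_degree_def using nth[OF that] F(1) by (auto intro!: Max_ge)
    qed
    then have "\<rho> \<le> r * card X" by (rule good_card[OF X(1)])
    \<comment> \<open>The quotient is \<open>\<rho> / r\<close> rounded up, so the integer
      \<open>card X\<close> dominates it as soon as it dominates \<open>\<rho> / r\<close>.\<close>
    then have "(\<rho> + r - 1) div r \<le> (r * card X + (r - 1)) div r" using r(2) by (intro div_le_mono) simp
    also have "\<dots> = card X" using r(2) by (subst div_mult_self4) auto
    finally have "real ((\<rho> + r - 1) div r) * M \<le> real (card X) * M"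
      using \<open>M \<ge> 0\<close> by (intro mult_right_mono) auto
    also have "\<dots> \<le> (\<Sum>t\<in>X. \<bar>c t\<bar>)"
      using Xm M_le sum_mono[of X "\<lambda>_. M" "\<lambda>t. \<bar>c t\<bar>"] by auto
    finally have B: "f ?x \<ge> a {} + real ((\<rho> + r - 1) div r) * M" using fx by simp
    have "finite (cube n)" by (simp add: cube_def finite_PiE)
    then have "f ?x \<le> Max (f ` cube n)" using output_point_cube by (intro Max_ge) auto
    moreover have "t \<le> C * 3 ^ d * (n * card F) ^ d"
    proof -
      \<comment> \<open>This is \<open>(n - 1) * (m - 1) \<ge> 0\<close>. Together with
        \<open>1 \<le> n * m\<close> it bounds the loop limit \<open>n + m + 1\<close> by
        \<open>3 * (n * m)\<close>, whence the factor \<open>3 ^ d\<close>.\<close>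
      have "n + m \<le> n * m + 1" using \<open>n \<ge> 1\<close> \<open>m \<ge> 1\<close> by (cases n; cases m) auto
      moreover have "1 \<le> n * m" using \<open>n \<ge> 1\<close> \<open>m \<ge> 1\<close> by simp
      ultimately have "Suc q \<le> 3 * (n * m)" by (simp add: q_def)
      then have "C * Suc q ^ d \<le> C * (3 * (n * m)) ^ d" by (intro mult_le_mono2 power_mono) auto
      moreover have "cost (Suc q) algorithm \<le> C * Suc q ^ d" using cost by simp
      ultimately have "t \<le> C * (3 * (n * m)) ^ d" using ex(2) by linarith
      then show ?thesis by (simp only: power_mult_distrib mF mult.assoc)
    qed
    ultimately show "let B = a {} + real ((rank_F2 n Is + r - 1) div r) * Min ((\<lambda>I. \<bar>a I\<bar>) ` F) in
          Max (f ` cube n) \<ge> B \<and>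
          (\<exists>t s. exec algorithm (input_state n a Is) t s \<and>
             t \<le> C * 3 ^ d * (n * card F) ^ d \<and>
             output_point n s \<in> cube n \<and> f (output_point n s) \<ge> B)"
      unfolding Let_def using B ex(1) output_point_cube by (auto simp: \<rho>_def M_def)
  qed
qed

end
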